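(* Let $w\in S_n$ be a vexillary permutation, and let $\mathfrak S_w(x_1,\dots,x_n;y_1,\dots,y_n)$ be its double Schubert polynomial. Then the polynomial $$x_1^n\cdots x_n^n\,\mathfrak S_w(x_n^{-1},\dots,x_1^{-1};1,\dots,1)$$ is a graded nonnegative sum of Lascoux polynomials $\mathfrak L_\alpha(x_1,\dots,x_n)$, $\alpha\in\mathbb N^n$.
   Context: Vexillary means $2143$-avoiding. $\mathbb N=\{0,1,2,\dots\}$, $|\alpha|=\alpha_1+\dots+\alpha_n$. For $i\in[n-1]$, $s_i$ acts on polynomials by swapping $x_i,x_{i+1}$, and $\partial_i(f)=\frac{f-s_if}{x_i-x_{i+1}}$, $\overline\partial_i(f)=\partial_i((1-x_{i+1})f)$, $\overline\pi_i(f)=\overline\partial_i(x_if)$. Double Schubert polynomials. With $w_0\in S_n$ the longest permutation and $ws_i$ denoting $w$ with the values $w(i),w(i+1)$ swapped: $\mathfrak S_{w_0}(\mathbf x;\mathbf y)=\prod_{i+j\le n}(x_i-y_j)$, and $\mathfrak S_w(\mathbf x;\mathbf y)=\partial_i\mathfrak S_{ws_i}(\mathbf x;\mathbf y)$ if $\ell(w)<\ell(ws_i)$. Lascoux polynomials. For $\alpha\in\mathbb N^n$, $\mathfrak L_\alpha=x_1^{\alpha_1}\cdots x_n^{\alpha_n}$ if $\alpha_1\ge\dots\ge\alpha_n$, and $\mathfrak L_\alpha=\overline\pi_i\mathfrak L_{\alpha\cdot s_i}$ if $\alpha_i<\alpha_{i+1}$, where $\alpha\cdot s_i$ is $\alpha$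 with entries $i,i+1$ swapped. A nonzero polynomial $f$ is a graded nonnegative sum of Lascoux polynomials if $f=\sum_\alpha(-1)^{|\alpha|-d}c_\alpha\mathfrak L_\alpha$ (a finite sum) with all $c_\alpha\ge0$, where $d$ is the lowest total degree of a term of $f$. *)

theory Defs
  imports
    "HOL-Library.Poly_Mapping"
    "HOL-Combinatorics.Permutations"
    "HOL-Computational_Algebra.Polynomial_Factorial"
begin

section \<open>Polynomials\<close>

text \<open>
  A polynomial over \<open>'a\<close> in variables indexed by \<^typ>\<open>nat\<close> is a finitely supported function from
  exponent vectors to coefficients, with the convolution product of \<^theory>\<open>HOL-Library.Poly_Mapping\<close>.
  The variables \<open>x\<^sub>1, \<dots>, x\<^sub>n\<close> are those with index in \<open>{1..n}\<close>.
\<close>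

type_synonym 'a mpoly = "(nat \<Rightarrow>\<^sub>0 nat) \<Rightarrow>\<^sub>0 'a"

definition Const :: "'a \<Rightarrow> 'a::comm_ring_1 mpoly" where
  "Const c = Poly_Mapping.single 0 c"

definition X :: "nat \<Rightarrow> 'a::comm_ring_1 mpoly" where
  "X i = Poly_Mapping.single (Poly_Mapping.single i 1) 1"

text \<open>
  \<open>eval \<phi> v f\<close> substitutes \<open>v i\<close> for the variable \<open>i\<close> and maps coefficients by the ring
  homomorphism \<open>\<phi>\<close>.
\<close>

definition eval :: "('a::comm_ring_1 \<Rightarrow> 'b::comm_ring_1) \<Rightarrow> (nat \<Rightarrow> 'b) \<Rightarrow> 'a mpoly \<Rightarrow> 'b" where
  "eval \<phi> v f =
    (\<Sum>m\<in>Poly_Mapping.keys f. \<phi> (Poly_Mapping.lookup f m) *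
      (\<Prod>i\<in>Poly_Mapping.keys m. v i ^ Poly_Mapping.lookup m i))"

definition total_degree :: "(nat \<Rightarrow>\<^sub>0 nat) \<Rightarrow> nat" where
  "total_degree m = (\<Sum>i\<in>Poly_Mapping.keys m. Poly_Mapping.lookup m i)"

definition lowest_degree :: "'a::comm_ring_1 mpoly \<Rightarrow> nat" where
  "lowest_degree f = Min (total_degree ` Poly_Mapping.keys f)"

section \<open>Divided differences\<close>

definition swap_vars :: "nat \<Rightarrow> 'a::comm_ring_1 mpoly \<Rightarrow> 'a mpoly" where
  "swap_vars i f = eval Const (\<lambda>j. X (transpose i (Suc i) j)) f"

definition div_diff :: "nat \<Rightarrow> 'a::idom mpoly \<Rightarrow> 'a mpoly" where
  "div_diff i f = (THE g. (X i - X (Suc i)) * g = f - swap_vars i f)"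

definition div_diff_bar :: "nat \<Rightarrow> 'a::idom mpoly \<Rightarrow> 'a mpoly" where
  "div_diff_bar i f = div_diff i ((1 - X (Suc i)) * f)"

definition pi_bar :: "nat \<Rightarrow> 'a::idom mpoly \<Rightarrow> 'a mpoly" where
  "pi_bar i f = div_diff_bar i (X i * f)"

text \<open>The quotient in the definition of \<^const>\<open>div_diff\<close> exists and is unique.\<close>

lemma X_power: "(X i :: 'a::comm_ring_1 mpoly) ^ k = Poly_Mapping.single (Poly_Mapping.single i k) 1"
  by (induction k) (simp_all add: X_def mult_single flip: single_add)

lemma prod_X_power:
  "finite A \<Longrightarrow> (\<Prod>i\<in>A. (X i :: 'a::comm_ring_1 mpoly) ^ k i) =
    Poly_Mapping.single (\<Sum>i\<in>A. Poly_Mapping.single i (k i)) 1"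
  by (induction A rule: finite_induct) (simp_all add: X_power mult_single)

lemma poly_mapping_sum_single:
  "(\<Sum>i\<in>Poly_Mapping.keys m. Poly_Mapping.single i (Poly_Mapping.lookup m i)) = m"
  by (rule poly_mapping_eqI)
    (simp add: lookup_sum lookup_single when_def in_keys_iff)

lemma eval_Const_X: "eval Const X f = f"
proof -
  have "eval Const X f =
    (\<Sum>m\<in>Poly_Mapping.keys f. Poly_Mapping.single m (Poly_Mapping.lookup f m))"
    unfolding eval_def
    by (simp add: prod_X_power poly_mapping_sum_single Const_def mult_single)
  then show ?thesis by (simp add: poly_mapping_sum_single)
qed

lemma dvd_prod_diff:
  fixes d :: "'a::comm_ring_1"
  assumes "finite A" "\<And>i. i \<in> A \<Longrightarrow> d dvd f i - g i"
  shows "d dvd prod f A - prod g A"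
  using assms
proof (induction A rule: finite_induct)
  case (insert a A)
  have "prod f (insert a A) - prod g (insert a A) =
      f a * (prod f A - prod g A) + (f a - g a) * prod g A"
    using insert.hyps by (simp add: algebra_simps)
  then show ?case using insert by (simp add: dvd_add)
qed simp

lemma X_diff_dvd: "(X i - X (Suc i)) dvd (f - swap_vars i (f :: 'a::comm_ring_1 mpoly))"
proof -
  let ?d = "X i - X (Suc i) :: 'a mpoly"
  have X: "?d dvd X j - X (transpose i (Suc i) j)" for j
  proof -
    have "?d dvd X (Suc i) - X i" by (metis dvd_minus_iff minus_diff_eq dvd_refl)
    then show ?thesis by (cases "j = i"; cases "j = Suc i") simp_all
  qed
  have pow: "?d dvd X j ^ k - X (transpose i (Suc i) j) ^ k" for j k
    using dvd_prod_diff[of "{..<k}" ?d "\<lambda>_. X j" "\<lambda>_. X (transpose i (Suc i) j)"] X by simp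
  have "f - swap_vars i f = eval Const X f - eval Const (\<lambda>j. X (transpose i (Suc i) j)) f"
    by (simp add: eval_Const_X swap_vars_def)
  also have "\<dots> = (\<Sum>m\<in>Poly_Mapping.keys f. Const (Poly_Mapping.lookup f m) *
      ((\<Prod>j\<in>Poly_Mapping.keys m. X j ^ Poly_Mapping.lookup m j) -
       (\<Prod>j\<in>Poly_Mapping.keys m. X (transpose i (Suc i) j) ^ Poly_Mapping.lookup m j)))"
    by (simp add: eval_def sum_subtractf right_diff_distrib)
  finally show ?thesis
    by (simp add: dvd_sum dvd_mult dvd_prod_diff pow)
qed

lemma X_diff_nonzero: "X i - X (Suc i) \<noteq> (0 :: 'a::comm_ring_1 mpoly)"
proof
  assume "X i - X (Suc i) = (0 :: 'a mpoly)"
  then have "Poly_Mapping.lookup (X i :: 'a mpoly) (Poly_Mapping.single i 1) =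
      Poly_Mapping.lookup (X (Suc i)) (Poly_Mapping.single i 1)" by simp
  moreover have "Poly_Mapping.single (Suc i) (1::nat) \<noteq> Poly_Mapping.single i 1"
    by (metis lookup_single_eq lookup_single_not_eq n_not_Suc_n zero_neq_one)
  ultimately show False by (simp add: X_def lookup_single when_def)
qed

lemma div_diff: "(X i - X (Suc i)) * div_diff i f = f - swap_vars i f"
proof -
  obtain g where "(X i - X (Suc i)) * g = f - swap_vars i f"
    using X_diff_dvd[of i f] by (metis dvd_def)
  then show ?thesis unfolding div_diff_def
    by (rule theI) (metis \<open>(X i - X (Suc i)) * g = f - swap_vars i f\<close> X_diff_nonzero mult_left_cancel)
qed

section \<open>Double Schubert polynomials\<close>

definition inversions :: "nat \<Rightarrow> (nat \<Rightarrow> nat) \<Rightarrow> nat" where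
  "inversions n w = card {(i, j). 1 \<le> i \<and> i < j \<and> j \<le> n \<and> w i > w j}"

definition vexillary :: "nat \<Rightarrow> (nat \<Rightarrow> nat) \<Rightarrow> bool" where
  "vexillary n w \<longleftrightarrow>
    \<not> (\<exists>i j k l. 1 \<le> i \<and> i < j \<and> j < k \<and> k < l \<and> l \<le> n \<and>
        w j < w i \<and> w i < w l \<and> w l < w k)"

definition longest_perm :: "nat \<Rightarrow> nat \<Rightarrow> nat" where
  "longest_perm n i = (if i \<in> {1..n} then n + 1 - i else i)"

text \<open>
  Polynomials in \<open>x\<close> and \<open>y\<close> are represented in \<open>\<int>[y][x]\<close>: the \<open>x\<close> variables are the outer ones,
  so that \<^const>\<open>div_diff\<close> treats the \<open>y\<close> variables as constants.
\<close>

type_synonym double_poly = "int mpoly mpoly"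

text \<open>
  The recursion leaves the choice of \<open>i\<close> open. It is therefore stated as a relation
  admitting every choice, and the polynomial is the unique one related to \<open>w\<close>.
\<close>

inductive double_schubert_rel :: "nat \<Rightarrow> (nat \<Rightarrow> nat) \<Rightarrow> double_poly \<Rightarrow> bool" for n where
  longest: "double_schubert_rel n (longest_perm n)
    (\<Prod>(i, j) \<in> {(i, j). 1 \<le> i \<and> 1 \<le> j \<and> i + j \<le> n}. X i - Const (X j))"
| descend: "double_schubert_rel n w (div_diff i f)"
  if "w permutes {1..n}" "1 \<le> i" "i < n"
    "inversions n w < inversions n (w \<circ> transpose i (Suc i))"
    "double_schubert_rel n (w \<circ> transpose i (Suc i)) f"

definition double_schubert :: "nat \<Rightarrow> (nat \<Rightarrow> nat) \<Rightarrow> double_poly" where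
  "double_schubert n w = (THE f. double_schubert_rel n w f)"

definition eval_double :: "(nat \<Rightarrow> 'b::comm_ring_1) \<Rightarrow> (nat \<Rightarrow> 'b) \<Rightarrow> double_poly \<Rightarrow> 'b" where
  "eval_double u v f = eval (eval of_int v) u f"

section \<open>Lascoux polynomials\<close>

text \<open>A weak composition in \<open>\<nat>\<^sup>n\<close> is an exponent vector supported in \<open>{1..n}\<close>.\<close>

definition compositions :: "nat \<Rightarrow> (nat \<Rightarrow>\<^sub>0 nat) set" where
  "compositions n = {\<alpha>. Poly_Mapping.keys \<alpha> \<subseteq> {1..n}}"

definition swap_parts :: "nat \<Rightarrow> (nat \<Rightarrow>\<^sub>0 nat) \<Rightarrow> (nat \<Rightarrow>\<^sub>0 nat)" where
  "swap_parts i \<alpha> = Poly_Mapping.map_key (transpose i (Suc i)) \<alpha>"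

inductive lascoux_rel :: "nat \<Rightarrow> (nat \<Rightarrow>\<^sub>0 nat) \<Rightarrow> int mpoly \<Rightarrow> bool" for n where
  dominant: "lascoux_rel n \<alpha> (Poly_Mapping.single \<alpha> 1)"
  if "\<alpha> \<in> compositions n"
    "\<And>i. 1 \<le> i \<Longrightarrow> i < n \<Longrightarrow> Poly_Mapping.lookup \<alpha> i \<ge> Poly_Mapping.lookup \<alpha> (Suc i)"
| ascend: "lascoux_rel n \<alpha> (pi_bar i f)"
  if "\<alpha> \<in> compositions n" "1 \<le> i" "i < n"
    "Poly_Mapping.lookup \<alpha> i < Poly_Mapping.lookup \<alpha> (Suc i)"
    "lascoux_rel n (swap_parts i \<alpha>) f"

definition lascoux :: "nat \<Rightarrow> (nat \<Rightarrow>\<^sub>0 nat) \<Rightarrow> int mpoly" where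
  "lascoux n \<alpha> = (THE f. lascoux_rel n \<alpha> f)"

text \<open>
  The sign \<open>(-1)\<^bsup>|\<alpha>| - d\<^esup>\<close> is written \<open>(-1)\<^bsup>|\<alpha>| + d\<^esup>\<close>, since subtraction on \<^typ>\<open>nat\<close> truncates.
\<close>

definition graded_nonneg_lascoux :: "nat \<Rightarrow> int mpoly \<Rightarrow> bool" where
  "graded_nonneg_lascoux n f \<longleftrightarrow> f \<noteq> 0 \<and>
    (\<exists>A c. finite A \<and> A \<subseteq> compositions n \<and> (\<forall>\<alpha>\<in>A. (0::int) \<le> c \<alpha>) \<and>
      f = (\<Sum>\<alpha>\<in>A. (-1) ^ (total_degree \<alpha> + lowest_degree f) * of_int (c \<alpha>) * lascoux n \<alpha>))"

end

theory Submission
  imports Defs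
begin

text \<open>
  Write \<open>F\<^sub>w\<close> for \<open>x\<^sub>1\<^sup>n \<cdots> x\<^sub>n\<^sup>n \<SS>\<^sub>w(1/x\<^sub>n, \<dots>, 1/x\<^sub>1; 1, \<dots>, 1)\<close>, called \<open>co_schubert n w\<close>
  below, and \<open>c\<^sub>a = x\<^sub>1 \<cdots> x\<^bsub>n-a\<^esub> (1 - x\<^bsub>n-a+1\<^esub>) \<cdots> (1 - x\<^sub>n)\<close> for \<open>column_factor n a\<close>.

  Under the substitution \<open>x\<^sub>i \<mapsto> 1/x\<^bsub>n+1-i\<^esub>\<close> the operator \<open>\<partial>\<^sub>i\<close> becomes \<open>F \<mapsto> x\<^sub>k x\<^bsub>k+1\<^esub> \<partial>\<^sub>k F\<close>
  with \<open>k = n - i\<close>, and the polynomial of the longest permutation becomes \<open>c\<^bsub>n-1\<^esub> c\<^bsub>n-2\<^esub> \<cdots> c\<^sub>0\<close>.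
  The proof rests on the identity \<open>x\<^sub>k x\<^bsub>k+1\<^esub> \<partial>\<^sub>k (c\<^sub>i H) = c\<^bsub>i-1\<^esub> \<pi>\<^sub>k H\<close>, where \<open>\<pi>\<^sub>k\<close> is \<open>pi_bar k\<close>
  (\<open>co_diff_column_factor\<close>): a step down in the weak order removes the last entry of one column
  of the diagram, at the price of a Demazure-Lascoux operator applied to all other columns. The factor \<open>c\<^sub>a\<close>
  commutes with every \<open>\<pi>\<^sub>k\<close> except \<open>k = n - a\<close>. If \<open>w\<close> is vexillary, the columns \<open>D\<^sub>j\<close>
  of its Rothe diagram form a chain under inclusion. This ensures that the exceptional operator is never in the
  way, and so
  \<open>F\<^sub>w = \<pi>\<^bsub>k\<^sub>1\<^esub> \<cdots> \<pi>\<^bsub>k\<^sub>r\<^esub> (\<Prod>\<^sub>j c\<^bsub>|D\<^sub>j|\<^esub>)\<close> for some word in the operators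
  (\<open>co_schubert_vexillary\<close>).

  It remains to expand a product of factors \<open>c\<^sub>a\<close> into words of operators applied to dominant monomials, with
  signs given by the degree: such a word applied to a dominant monomial is a single Lascoux polynomial
  (\<open>pi_bar_word_dominant\<close>), and prepending further operators keeps this form. The factors
  are multiplied together in the order of increasing \<open>a\<close>. In each step \<open>c\<^sub>a\<close> meets only words
  that commute with it, so that only
  \<open>x\<^sup>\<mu> \<Prod>\<^bsub>k>n-a\<^esub> (1 - x\<^sub>k)\<close> with \<open>\<mu>\<close> dominant has to be expanded. On a block \<open>p, \<dots>, q\<close> of equal parts of
  \<open>\<mu>\<close> one has \<open>(1 - x\<^sub>p) \<cdots> (1 - x\<^sub>q) = 1 - \<pi>\<^bsub>q-1\<^esub> \<cdots> \<pi>\<^sub>p x\<^sub>p\<close>, and multiplying by \<open>x\<^sub>p\<close> raises the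
  first part of the block, which leaves \<open>\<mu>\<close> dominant (\<open>monomial_times_tail\<close>).

  The signs come out relative to \<open>d = \<Sum>\<^sub>j (n - |D\<^sub>j|) = n\<^sup>2 - \<ell>(w)\<close>, and this is the lowest degree of \<open>F\<^sub>w\<close>. The
  word formula shows that no term has smaller degree. On the other hand, \<open>\<ell>(w)\<close> operators
  \<open>x\<^sub>k x\<^bsub>k+1\<^esub> \<partial>\<^sub>k\<close>, each of which raises the order at the origin by at least one, lead from \<open>F\<^sub>w\<close> to
  \<open>F\<^bsub>id\<^esub> = (x\<^sub>1 \<cdots> x\<^sub>n)\<^sup>n\<close>, of order exactly \<open>n\<^sup>2\<close>.

  Since the Schubert and Lascoux polynomials are given by recursions that leave a choice open, their existence and
  uniqueness are established along the way, from the braid relations of the operators (\<open>sort_rec_ascent\<close>).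
\<close>

section \<open>Substitution as a ring homomorphism\<close>

lemma mpoly_induct:
  fixes f :: "'a::comm_ring_1 mpoly"
  assumes "\<And>m c. P (Poly_Mapping.single m c)" and "\<And>f g. P f \<Longrightarrow> P g \<Longrightarrow> P (f + g)"
  shows "P f"
proof -
  have "P (\<Sum>m\<in>A. Poly_Mapping.single m (Poly_Mapping.lookup f m))" if "finite A" for A
    using that
  proof induction
    case empty
    then show ?case using assms(1)[of 0 0] by simp
  qed (simp add: assms)
  from this[OF finite_keys[of f]] show ?thesis by (simp add: poly_mapping_sum_single)
qed

definition ring_hom :: "('a::comm_ring_1 \<Rightarrow> 'b::comm_ring_1) \<Rightarrow> bool" where
  "ring_hom \<phi> \<longleftrightarrow> \<phi> 1 = 1 \<and> (\<forall>a b. \<phi> (a + b) = \<phi> a + \<phi> b) \<and> (\<forall>a b. \<phi> (a * b) = \<phi> a * \<phi> b)"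

lemma ring_hom_simps:
  assumes "ring_hom \<phi>"
  shows "\<phi> 0 = 0" "\<phi> 1 = 1" "\<phi> (a + b) = \<phi> a + \<phi> b" "\<phi> (a * b) = \<phi> a * \<phi> b"
    "\<phi> (- a) = - \<phi> a" "\<phi> (a - b) = \<phi> a - \<phi> b"
proof -
  show 0: "\<phi> 0 = 0" using assms unfolding ring_hom_def by (metis add.right_neutral add_cancel_left_right)
  show *: "\<phi> (- a) = - \<phi> a" for a
    using assms 0 unfolding ring_hom_def by (metis add.right_inverse add_eq_0_iff)
  show "\<phi> (a - b) = \<phi> a - \<phi> b"
    using assms * unfolding ring_hom_def by (metis add_uminus_conv_diff)
qed (use assms in \<open>auto simp: ring_hom_def\<close>)

lemma ring_hom_prod: "ring_hom \<phi> \<Longrightarrow> \<phi> (prod f A) = (\<Prod>i\<in>A. \<phi> (f i))"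
  by (induction A rule: infinite_finite_induct) (auto simp: ring_hom_simps)

lemma ring_hom_power: "ring_hom \<phi> \<Longrightarrow> \<phi> (a ^ k) = \<phi> a ^ k"
  by (induction k) (auto simp: ring_hom_simps)

lemma ring_hom_Const: "ring_hom Const"
  by (auto simp: ring_hom_def Const_def single_add mult_single)

lemma ring_hom_of_int: "ring_hom of_int"
  by (auto simp: ring_hom_def)

definition monomial_at :: "(nat \<Rightarrow> 'b::comm_ring_1) \<Rightarrow> (nat \<Rightarrow>\<^sub>0 nat) \<Rightarrow> 'b" where
  "monomial_at v m = (\<Prod>i\<in>Poly_Mapping.keys m. v i ^ Poly_Mapping.lookup m i)"

lemma monomial_at_superset:
  "finite A \<Longrightarrow> Poly_Mapping.keys m \<subseteq> A \<Longrightarrow> monomial_at v m = (\<Prod>i\<in>A. v i ^ Poly_Mapping.lookup m i)"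
  unfolding monomial_at_def by (rule prod.mono_neutral_left) (auto simp: in_keys_iff)

lemma monomial_at_add: "monomial_at v (m + m') = monomial_at v m * monomial_at v m'"
  using monomial_at_superset[of "Poly_Mapping.keys m \<union> Poly_Mapping.keys m'" _ v] keys_add[of m m']
  by (simp add: lookup_add power_add prod.distrib)

lemma eval_superset:
  assumes "ring_hom \<phi>" "finite A" "Poly_Mapping.keys f \<subseteq> A"
  shows "eval \<phi> v f = (\<Sum>m\<in>A. \<phi> (Poly_Mapping.lookup f m) * monomial_at v m)"
  unfolding eval_def monomial_at_def
  by (rule sum.mono_neutral_left) (use assms in \<open>auto simp: in_keys_iff ring_hom_simps\<close>)

lemma eval_add:
  assumes "ring_hom \<phi>"
  shows "eval \<phi> v (f + g) = eval \<phi> v f + eval \<phi> v g"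
  using eval_superset[OF assms, of "Poly_Mapping.keys f \<union> Poly_Mapping.keys g" _ v] keys_add[of f g] assms
  by (simp add: lookup_add sum.distrib distrib_right ring_hom_simps)

lemma eval_single:
  assumes "ring_hom \<phi>"
  shows "eval \<phi> v (Poly_Mapping.single m c) = \<phi> c * monomial_at v m"
  using eval_superset[OF assms, of "{m}" "Poly_Mapping.single m c" v] by simp

lemma eval_mult:
  assumes "ring_hom \<phi>"
  shows "eval \<phi> v (f * g) = eval \<phi> v f * eval \<phi> v g"
proof (induction f rule: mpoly_induct)
  case (1 m c)
  show ?case
    by (induction g rule: mpoly_induct)
      (simp_all add: eval_single eval_add assms mult_single monomial_at_add ring_hom_simps algebra_simps)
qed (simp add: distrib_right eval_add assms)

lemma ring_hom_eval:
  assumes "ring_hom \<phi>"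
  shows "ring_hom (eval \<phi> v)"
proof -
  have "eval \<phi> v 1 = 1"
    using eval_single[OF assms, of v 0 1] by (simp add: monomial_at_def assms ring_hom_simps)
  then show ?thesis by (auto simp: ring_hom_def eval_add[OF assms] eval_mult[OF assms])
qed

lemma eval_X: "ring_hom \<phi> \<Longrightarrow> eval \<phi> v (X i) = v i"
  by (simp add: X_def eval_single ring_hom_simps monomial_at_def)

lemma eval_Const: "ring_hom \<phi> \<Longrightarrow> eval \<phi> v (Const c) = \<phi> c"
  by (simp add: Const_def eval_single ring_hom_simps monomial_at_def)

lemma ring_hom_monomial_at: "ring_hom \<phi> \<Longrightarrow> ring_hom \<psi> \<Longrightarrow> \<psi> (monomial_at u m) = monomial_at (\<lambda>i. \<psi> (u i)) m"
  by (simp add: monomial_at_def ring_hom_prod ring_hom_power)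

lemma eval_eval:
  assumes "ring_hom \<phi>"
  shows "eval \<phi> v (eval Const u f) = eval \<phi> (\<lambda>i. eval \<phi> v (u i)) f"
  by (induction f rule: mpoly_induct)
    (simp_all add: eval_single eval_add eval_mult eval_Const assms ring_hom_Const
      ring_hom_monomial_at[OF assms ring_hom_eval])

lemma eval_swap_vars:
  "ring_hom \<phi> \<Longrightarrow> eval \<phi> v (swap_vars i f) = eval \<phi> (\<lambda>j. v (transpose i (Suc i) j)) f"
  by (simp add: swap_vars_def eval_eval eval_X)

section \<open>Exchanging adjacent variables\<close>

lemma ring_hom_swap_vars: "ring_hom (swap_vars i)"
  unfolding swap_vars_def by (rule ring_hom_eval[OF ring_hom_Const])

lemmas swap_vars_simps [simp] = ring_hom_simps[OF ring_hom_swap_vars]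

lemma swap_vars_X [simp]: "swap_vars i (X j) = X (transpose i (Suc i) j)"
  by (simp add: swap_vars_def eval_X ring_hom_Const)

lemma swap_vars_swap_vars:
  "swap_vars i (swap_vars j f) = eval Const (\<lambda>k. X (transpose i (Suc i) (transpose j (Suc j) k))) f"
  by (subst (1) swap_vars_def) (simp add: eval_swap_vars ring_hom_Const)

lemma swap_vars_involution [simp]: "swap_vars i (swap_vars i f) = f"
  by (simp add: swap_vars_swap_vars eval_Const_X)

lemma swap_vars_commute:
  assumes "Suc i < j"
  shows "swap_vars i (swap_vars j f) = swap_vars j (swap_vars i f)"
proof -
  have "transpose i (Suc i) (transpose j (Suc j) k) = transpose j (Suc j) (transpose i (Suc i) k)" for k
    using assms by (auto simp: transpose_def)
  then show ?thesis by (simp add: swap_vars_swap_vars)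
qed

lemma swap_vars_braid:
  "swap_vars i (swap_vars (Suc i) (swap_vars i f)) = swap_vars (Suc i) (swap_vars i (swap_vars (Suc i) f))"
proof -
  have "transpose i (Suc i) (transpose (Suc i) (Suc (Suc i)) (transpose i (Suc i) k))
      = transpose (Suc i) (Suc (Suc i)) (transpose i (Suc i) (transpose (Suc i) (Suc (Suc i)) k))" for k
    by (auto simp: transpose_def)
  then show ?thesis
    by (simp add: swap_vars_swap_vars swap_vars_def[of i "eval Const _ f"] swap_vars_def[of "Suc i" "eval Const _ f"] eval_eval ring_hom_Const eval_X)
qed

section \<open>Divided differences and Demazure-Lascoux operators\<close>

lemma div_diff_unique: "(X i - X (Suc i)) * g = f - swap_vars i f \<Longrightarrow> div_diff i f = g"
  by (metis div_diff X_diff_nonzero mult_left_cancel)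

lemma div_diff_add: "div_diff i (f + g) = div_diff i f + div_diff i g"
  by (rule div_diff_unique) (simp add: distrib_left div_diff)

lemma div_diff_minus: "div_diff i (- f) = - div_diff i f"
  by (rule div_diff_unique) (simp add: div_diff)

lemma div_diff_0 [simp]: "div_diff i 0 = 0"
  by (rule div_diff_unique) simp

lemma div_diff_symmetric_mult:
  assumes "swap_vars i p = p"
  shows "div_diff i (p * f) = p * div_diff i f"
  by (rule div_diff_unique) (simp add: assms div_diff mult.left_commute right_diff_distrib)

lemma swap_vars_div_diff: "swap_vars i (div_diff i f) = div_diff i f"
proof -
  have "(X i - X (Suc i)) * swap_vars i (div_diff i f) = - swap_vars i ((X i - X (Suc i)) * div_diff i f)"
    by (simp add: algebra_simps)
  also have "\<dots> = f - swap_vars i f" unfolding div_diff by simp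
  finally show ?thesis using div_diff_unique by metis
qed

lemma div_diff_commute:
  assumes "Suc i < j"
  shows "div_diff i (div_diff j f) = div_diff j (div_diff i f)"
proof -
  have tr: "transpose i (Suc i) j = j" "transpose i (Suc i) (Suc j) = Suc j"
    "transpose j (Suc j) i = i" "transpose j (Suc j) (Suc i) = Suc i"
    using assms by (auto simp: transpose_def)
  have "(X j - X (Suc j)) * ((X i - X (Suc i)) * div_diff i (div_diff j f))
     = (X j - X (Suc j)) * div_diff j f - swap_vars i ((X j - X (Suc j)) * div_diff j f)"
    unfolding div_diff[of i] by (simp only: swap_vars_simps swap_vars_X tr right_diff_distrib[of _ "div_diff j f"])
  also have "\<dots> = (X i - X (Suc i)) * div_diff i f - swap_vars j ((X i - X (Suc i)) * div_diff i f)"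
    by (simp only: div_diff) (simp add: swap_vars_commute[OF assms])
  also have "\<dots> = (X i - X (Suc i)) * ((X j - X (Suc j)) * div_diff j (div_diff i f))"
    unfolding div_diff[of j] by (simp only: swap_vars_simps swap_vars_X tr right_diff_distrib[of _ "div_diff i f"])
  finally have "(X i - X (Suc i)) * ((X j - X (Suc j)) * div_diff i (div_diff j f))
     = (X i - X (Suc i)) * ((X j - X (Suc j)) * div_diff j (div_diff i f))"
    by (simp only: mult.left_commute)
  then show ?thesis by (simp only: mult_cancel_left X_diff_nonzero simp_thms)
qed

text \<open>
  Multiplied by the Vandermonde product of the three variables, both sides become the alternating sum of \<open>f\<close> over
  all permutations of the variables.
\<close>

lemma div_diff_braid:
  fixes f :: "'a::idom mpoly"
  shows "div_diff i (div_diff (Suc i) (div_diff i f)) = div_diff (Suc i) (div_diff i (div_diff (Suc i) f))"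
proof -
  let ?x = "X i :: 'a mpoly" and ?y = "X (Suc i) :: 'a mpoly" and ?z = "X (Suc (Suc i)) :: 'a mpoly"
  let ?s = "swap_vars i :: 'a mpoly \<Rightarrow> _" and ?t = "swap_vars (Suc i) :: 'a mpoly \<Rightarrow> _"
  let ?D = "(?x - ?y) * (?x - ?z) * (?y - ?z)"
  have tr: "transpose i (Suc i) (Suc (Suc i)) = Suc (Suc i)" "transpose (Suc i) (Suc (Suc i)) i = i"
    by (auto simp: transpose_def)
  have xz: "?x - ?z \<noteq> 0"
  proof
    assume "?x - ?z = 0"
    then have "?t (?x - ?z) = 0" by simp
    then show False using X_diff_nonzero[of i, where 'a='a] by (simp add: tr)
  qed
  have st: "?s ?D = - ?D" "?t ?D = - ?D"
    by (simp_all add: tr algebra_simps)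
  have sD: "?s (?D * g) = - (?D * ?s g)" and tD: "?t (?D * g) = - (?D * ?t g)" for g
    by (simp_all only: ring_hom_simps(4)[OF ring_hom_swap_vars, where a = ?D and b = g] st mult_minus_left)
  have 1: "?D * div_diff (Suc i) (div_diff i f) =
      (?x - ?z) * (f - ?s f) - (?x - ?y) * (?t f - ?t (?s f))"
  proof -
    have "?D * div_diff (Suc i) (div_diff i f) =
        (?x - ?y) * (?x - ?z) * ((?y - ?z) * div_diff (Suc i) (div_diff i f))" by (simp add: mult.assoc)
    also have "\<dots> = (?x - ?z) * ((?x - ?y) * div_diff i f) - (?x - ?y) * ?t ((?x - ?y) * div_diff i f)"
      unfolding div_diff[of "Suc i"] by (simp add: tr algebra_simps)
    finally show ?thesis unfolding div_diff[of i] by simp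
  qed
  have 2: "?D * div_diff i (div_diff (Suc i) f) =
      (?x - ?z) * (f - ?t f) - (?y - ?z) * (?s f - ?s (?t f))"
  proof -
    have "?D * div_diff i (div_diff (Suc i) f) =
        (?y - ?z) * (?x - ?z) * ((?x - ?y) * div_diff i (div_diff (Suc i) f))" by (simp add: mult_ac)
    also have "\<dots> = (?x - ?z) * ((?y - ?z) * div_diff (Suc i) f) - (?y - ?z) * ?s ((?y - ?z) * div_diff (Suc i) f)"
      unfolding div_diff[of i] by (simp add: tr algebra_simps)
    finally show ?thesis unfolding div_diff[of "Suc i"] by simp
  qed
  let ?a = "f - ?s f - ?t f + ?s (?t f) + ?t (?s f) - ?s (?t (?s f))"
  let ?h = "div_diff (Suc i) (div_diff i f)" and ?k = "div_diff i (div_diff (Suc i) f)"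
  have "(?x - ?y) * (?D * div_diff i ?h) = ?D * ((?x - ?y) * div_diff i ?h)" by (simp only: mult.left_commute)
  also have "\<dots> = ?D * ?h + ?s (?D * ?h)"
    unfolding div_diff[of i ?h] sD by (simp only: right_diff_distrib) simp
  also have "\<dots> = (?x - ?y) * ?a"
    unfolding 1 by (simp add: tr algebra_simps)
  finally have L: "?D * div_diff i ?h = ?a" using X_diff_nonzero[of i, where 'a='a] by simp
  have "(?y - ?z) * (?D * div_diff (Suc i) ?k) = ?D * ((?y - ?z) * div_diff (Suc i) ?k)" by (simp only: mult.left_commute)
  also have "\<dots> = ?D * ?k + ?t (?D * ?k)"
    unfolding div_diff[of "Suc i" ?k] tD by (simp only: right_diff_distrib) simp
  also have "\<dots> = (?y - ?z) * ?a"
    unfolding 2 by (simp add: tr algebra_simps swap_vars_braid)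
  finally have R: "?D * div_diff (Suc i) ?k = ?a" using X_diff_nonzero[of "Suc i", where 'a='a] by simp
  have "?D \<noteq> 0" using xz X_diff_nonzero[of i, where 'a='a] X_diff_nonzero[of "Suc i", where 'a='a] by simp
  then show ?thesis using L R by (metis mult_left_cancel)
qed

lemma pi_bar_alt: "pi_bar i f = div_diff i (X i * (1 - X (Suc i)) * f)"
  by (simp add: pi_bar_def div_diff_bar_def mult_ac)

lemma pi_bar_add: "pi_bar i (f + g) = pi_bar i f + pi_bar i g"
  by (simp add: pi_bar_alt distrib_left div_diff_add)

lemma pi_bar_minus: "pi_bar i (- f) = - pi_bar i f"
  by (simp add: pi_bar_alt div_diff_minus)

lemma pi_bar_0 [simp]: "pi_bar i 0 = 0"
  by (simp add: pi_bar_alt)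

lemma pi_bar_symmetric_mult:
  "swap_vars i p = p \<Longrightarrow> pi_bar i (p * f) = p * pi_bar i f"
  using div_diff_symmetric_mult[of i p "X i * (1 - X (Suc i)) * f"] by (simp add: pi_bar_alt mult_ac)

lemma pi_bar_1: "pi_bar i 1 = 1"
  unfolding pi_bar_alt by (rule div_diff_unique) (simp add: algebra_simps)

lemma pi_bar_symmetric: "swap_vars i p = p \<Longrightarrow> pi_bar i p = p"
  using pi_bar_symmetric_mult[of i p 1] by (simp add: pi_bar_1)

lemma swap_vars_pi_bar: "swap_vars i (pi_bar i f) = pi_bar i f"
  by (simp add: pi_bar_alt swap_vars_div_diff)

lemma pi_bar_idem: "pi_bar i (pi_bar i f) = pi_bar i f"
  by (simp add: pi_bar_symmetric swap_vars_pi_bar)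

lemma pi_bar_commute:
  assumes "Suc i < j"
  shows "pi_bar i (pi_bar j f) = pi_bar j (pi_bar i f)"
proof -
  let ?p = "\<lambda>i. X i * (1 - X (Suc i)) :: 'a mpoly"
  have "swap_vars i (?p j) = ?p j" "swap_vars j (?p i) = ?p i"
    using assms by (auto simp: transpose_def)
  then have "pi_bar i (pi_bar j f) = div_diff i (div_diff j (?p i * (?p j * f)))"
    "pi_bar j (pi_bar i f) = div_diff j (div_diff i (?p j * (?p i * f)))"
    unfolding pi_bar_alt by (metis div_diff_symmetric_mult)+
  then show ?thesis using div_diff_commute[OF assms] by (simp add: mult_ac)
qed

lemma div_diff_X_mult: "div_diff i (X j * f) =
   X (transpose i (Suc i) j) * div_diff i f + (if j = i then f else if j = Suc i then - f else 0)"
proof (rule div_diff_unique)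
  have "(X i - X (Suc i)) * (X (transpose i (Suc i) j) * div_diff i f + (if j = i then f else if j = Suc i then - f else 0))
    = X (transpose i (Suc i) j) * ((X i - X (Suc i)) * div_diff i f) + (X i - X (Suc i)) * (if j = i then f else if j = Suc i then - f else 0)"
    by (simp only: distrib_left mult.left_commute)
  also have "\<dots> = X j * f - swap_vars i (X j * f)"
    unfolding div_diff by (auto simp: algebra_simps transpose_def)
  finally show "(X i - X (Suc i)) * (X (transpose i (Suc i) j) * div_diff i f + (if j = i then f else if j = Suc i then - f else 0))
    = X j * f - swap_vars i (X j * f)" .
qed

text \<open>
  Write \<open>a\<^bsub>jk\<^esub> = x\<^sub>j (1 - x\<^sub>k)\<close>. Both sides equal a threefold divided difference of \<open>a\<^sub>1\<^sub>2 a\<^sub>1\<^sub>3 a\<^sub>2\<^sub>3 f\<close>: pulling the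
  factors \<open>a\<^bsub>jk\<^esub>\<close> into the middle operator produces one correction term by the Leibniz rule, and the outer
  operator annihilates it because it is symmetric. Thus the relation reduces to that for divided differences.
\<close>

lemma pi_bar_braid:
  fixes f :: "'a::idom mpoly"
  shows "pi_bar i (pi_bar (Suc i) (pi_bar i f)) = pi_bar (Suc i) (pi_bar i (pi_bar (Suc i) f))"
proof -
  let ?x = "X i :: 'a mpoly" and ?y = "X (Suc i) :: 'a mpoly" and ?z = "X (Suc (Suc i)) :: 'a mpoly"
  let ?j = "Suc i"
  have tr: "transpose i (Suc i) (Suc (Suc i)) = Suc (Suc i)" "transpose (Suc i) (Suc (Suc i)) i = i"
    by (auto simp: transpose_def)
  let ?w = "?x * (1 - ?y) * (?x * (1 - ?z)) * (?y * (1 - ?z)) * f"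
  define u where "u = div_diff i (?x * (1 - ?y) * f)"
  define v where "v = div_diff ?j (?y * (1 - ?z) * f)"
  have su: "swap_vars i u = u" and sv: "swap_vars ?j v = v"
    by (simp_all add: u_def v_def swap_vars_div_diff)
  have A: "div_diff i ?w = ?x * ?y * (1 - ?z) * (1 - ?z) * u"
  proof -
    have "div_diff i ((?x * ?y * (1 - ?z) * (1 - ?z)) * (?x * (1 - ?y) * f)) = ?x * ?y * (1 - ?z) * (1 - ?z) * u"
      unfolding u_def by (rule div_diff_symmetric_mult) (simp add: tr mult_ac)
    then show ?thesis by (simp add: mult_ac)
  qed
  have B: "div_diff ?j ?w = ?x * ?x * (1 - ?y) * (1 - ?z) * v"
  proof -
    have "div_diff ?j ((?x * ?x * (1 - ?y) * (1 - ?z)) * (?y * (1 - ?z) * f)) = ?x * ?x * (1 - ?y) * (1 - ?z) * v"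
      unfolding v_def by (rule div_diff_symmetric_mult) (simp add: tr mult_ac)
    then show ?thesis by (simp add: mult_ac)
  qed
  \<comment> \<open>The last summand is the correction term; \<open>div_diff i\<close> annihilates it.\<close>
  have C: "div_diff ?j (?x * ?y * (1 - ?z) * (1 - ?z) * u)
      = ?x * (1 - ?y) * div_diff ?j (?y * (1 - ?z) * u) + ?x * ?y * (1 - ?z) * u"
  proof -
    let ?q = "?y * (1 - ?z) * u"
    have "?x * ?y * (1 - ?z) * (1 - ?z) * u = ?x * ?q + - (?z * (?x * ?q))" by (simp add: algebra_simps)
    then have "div_diff ?j (?x * ?y * (1 - ?z) * (1 - ?z) * u) = div_diff ?j (?x * ?q) - div_diff ?j (?z * (?x * ?q))"
      by (simp only: div_diff_add div_diff_minus) simp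
    then show ?thesis by (simp only: div_diff_X_mult tr) (simp add: algebra_simps)
  qed
  have D: "div_diff i (?x * ?x * (1 - ?y) * (1 - ?z) * v)
      = ?y * (1 - ?z) * div_diff i (?x * (1 - ?y) * v) + ?x * (1 - ?y) * (1 - ?z) * v"
  proof -
    let ?q = "?x * (1 - ?y) * v"
    have z: "div_diff i ((1 - ?z) * q) = (1 - ?z) * div_diff i q" for q
      by (rule div_diff_symmetric_mult) (simp add: tr)
    have "?x * ?x * (1 - ?y) * (1 - ?z) * v = (1 - ?z) * (?x * ?q)" by (simp add: algebra_simps)
    then have "div_diff i (?x * ?x * (1 - ?y) * (1 - ?z) * v) = (1 - ?z) * div_diff i (?x * ?q)"
      by (simp only: z)
    then show ?thesis by (simp only: div_diff_X_mult) (simp add: algebra_simps)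
  qed
  have zero: "div_diff k p = 0" if "swap_vars k p = p" for k and p :: "'a mpoly"
    by (rule div_diff_unique) (simp add: that)
  have C0: "div_diff i (?x * ?y * (1 - ?z) * u) = 0"
    by (rule zero) (simp add: tr su mult_ac)
  have D0: "div_diff ?j (?x * (1 - ?y) * (1 - ?z) * v) = 0"
    by (rule zero) (simp add: tr sv mult_ac)
  have "pi_bar i (pi_bar ?j (pi_bar i f)) = div_diff i (div_diff ?j (div_diff i ?w))"
    unfolding A C div_diff_add C0 by (simp add: pi_bar_alt u_def)
  moreover have "pi_bar ?j (pi_bar i (pi_bar ?j f)) = div_diff ?j (div_diff i (div_diff ?j ?w))"
    unfolding B D div_diff_add D0 by (simp add: pi_bar_alt v_def)
  ultimately show ?thesis by (simp add: div_diff_braid)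
qed

section \<open>Recursion along sorting steps\<close>

definition ascent :: "nat \<Rightarrow> (nat \<Rightarrow> nat) \<Rightarrow> nat \<Rightarrow> bool" where
  "ascent n w i \<longleftrightarrow> 1 \<le> i \<and> i < n \<and> w i < w (Suc i)"

abbreviation swap_at :: "(nat \<Rightarrow> nat) \<Rightarrow> nat \<Rightarrow> nat \<Rightarrow> nat" where
  "swap_at w i \<equiv> w \<circ> transpose i (Suc i)"

definition inversion_pairs :: "nat \<Rightarrow> (nat \<Rightarrow> nat) \<Rightarrow> (nat \<times> nat) set" where
  "inversion_pairs n w = {(i, j). 1 \<le> i \<and> i < j \<and> j \<le> n \<and> w i > w j}"

lemma inversions_eq_card: "inversions n w = card (inversion_pairs n w)"
  by (simp add: inversions_def inversion_pairs_def)

lemma inversion_pairs_subset: "inversion_pairs n w \<subseteq> {1..n} \<times> {1..n}"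
  by (auto simp: inversion_pairs_def)

lemma finite_inversion_pairs: "finite (inversion_pairs n w)"
  using finite_subset[OF inversion_pairs_subset] by blast

lemma inversions_le: "inversions n w \<le> n * n"
  using card_mono[OF _ inversion_pairs_subset] by (simp add: inversions_eq_card)

lemma swap_inversion_pairs:
  assumes "1 \<le> i" "i < n" "(p, q) \<in> inversion_pairs n w" "(p, q) \<noteq> (i, Suc i)"
  shows "(transpose i (Suc i) p, transpose i (Suc i) q) \<in> inversion_pairs n (swap_at w i) - {(i, Suc i)}"
  using assms by (auto simp: inversion_pairs_def transpose_def split: if_splits)

text \<open>
  Exchanging the two positions in each pair is an injection on inversions that misses only the new one \<open>(i, i + 1)\<close>.
\<close>

lemma inversions_swap_ascent:
  assumes "ascent n w i"
  shows "inversions n (swap_at w i) = Suc (inversions n w)"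
proof -
  let ?t = "transpose i (Suc i)"
  have i: "1 \<le> i" "i < n" "w i < w (Suc i)" using assms by (auto simp: ascent_def)
  have "inversion_pairs n (swap_at w i) = insert (i, Suc i) (map_prod ?t ?t ` inversion_pairs n w)"
  proof (intro equalityI subsetI)
    fix z assume z: "z \<in> inversion_pairs n (swap_at w i)"
    obtain p q where pq: "z = (p, q)" by fastforce
    show "z \<in> insert (i, Suc i) (map_prod ?t ?t ` inversion_pairs n w)"
    proof (cases "z = (i, Suc i)")
      case False
      then have "(?t p, ?t q) \<in> inversion_pairs n (swap_at (swap_at w i) i)"
        using swap_inversion_pairs[OF i(1,2)] z pq by blast
      moreover have "swap_at (swap_at w i) i = w" by (simp add: comp_assoc)
      ultimately have "(?t p, ?t q) \<in> inversion_pairs n w" by simp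
      then have "map_prod ?t ?t (?t p, ?t q) \<in> map_prod ?t ?t ` inversion_pairs n w" by (rule imageI)
      then show ?thesis by (simp add: pq)
    qed simp
  next
    fix z assume z: "z \<in> insert (i, Suc i) (map_prod ?t ?t ` inversion_pairs n w)"
    have "(i, Suc i) \<notin> inversion_pairs n w" "(i, Suc i) \<in> inversion_pairs n (swap_at w i)"
      using i by (auto simp: inversion_pairs_def)
    then show "z \<in> inversion_pairs n (swap_at w i)"
      using z swap_inversion_pairs[OF i(1,2)] by fastforce
  qed
  moreover have "(i, Suc i) \<notin> map_prod ?t ?t ` inversion_pairs n w"
    by (auto simp: inversion_pairs_def transpose_def split: if_splits)
  moreover have "card (map_prod ?t ?t ` inversion_pairs n w) = card (inversion_pairs n w)"
    by (rule card_image) (rule inj_on_subset[OF prod.inj_map[OF inj_on_transpose inj_on_transpose] subset_UNIV])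
  ultimately show ?thesis
    by (simp add: inversions_eq_card finite_inversion_pairs)
qed

lemma ascentI_inversions:
  assumes "1 \<le> i" "i < n" "inversions n w < inversions n (swap_at w i)"
  shows "ascent n w i"
proof (rule ccontr)
  let ?t = "transpose i (Suc i)"
  assume "\<not> ascent n w i"
  then have le: "w (Suc i) \<le> w i" using assms by (auto simp: ascent_def)
  have "map_prod ?t ?t ` inversion_pairs n (swap_at w i) \<subseteq> inversion_pairs n w"
  proof
    fix z assume "z \<in> map_prod ?t ?t ` inversion_pairs n (swap_at w i)"
    then obtain p q where pq: "(p, q) \<in> inversion_pairs n (swap_at w i)" "z = (?t p, ?t q)" by auto
    moreover have "(p, q) \<noteq> (i, Suc i)" using pq(1) le by (auto simp: inversion_pairs_def)
    moreover have "swap_at (swap_at w i) i = w" by (simp add: comp_assoc)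
    ultimately show "z \<in> inversion_pairs n w" using swap_inversion_pairs[OF assms(1,2) pq(1)] by simp
  qed
  moreover have "card (map_prod ?t ?t ` inversion_pairs n (swap_at w i)) = card (inversion_pairs n (swap_at w i))"
    by (rule card_image) (rule inj_on_subset[OF prod.inj_map[OF inj_on_transpose inj_on_transpose] subset_UNIV])
  ultimately show False
    using assms(3) card_mono[OF finite_inversion_pairs[of n w]] unfolding inversions_eq_card by (metis not_less)
qed

lemma swap_at_decreases:
  "ascent n w i \<Longrightarrow> n * n - inversions n (swap_at w i) < n * n - inversions n w"
  using inversions_swap_ascent[of n w i] inversions_le[of n "swap_at w i"] by simp

text \<open>
  The common pattern of the recursions for Schubert and Lascoux polynomials. The ascent is selected arbitrarily;
  lemma \<open>sort_rec_ascent\<close> shows that any other selection gives the same value.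
\<close>

function sort_rec :: "nat \<Rightarrow> (nat \<Rightarrow> 'b \<Rightarrow> 'b) \<Rightarrow> ((nat \<Rightarrow> nat) \<Rightarrow> 'b) \<Rightarrow> (nat \<Rightarrow> nat) \<Rightarrow> 'b" where
  "sort_rec n D base w =
    (if \<exists>i. ascent n w i
     then D (SOME i. ascent n w i) (sort_rec n D base (swap_at w (SOME i. ascent n w i)))
     else base w)"
  by auto
termination
  by (relation "measure (\<lambda>(n, _, _, w). n * n - inversions n w)")
    (auto intro!: swap_at_decreases intro: someI)

declare sort_rec.simps [simp del]

lemma sort_rec_base: "(\<And>i. \<not> ascent n w i) \<Longrightarrow> sort_rec n D base w = base w"
  using sort_rec.simps[of n D base w] by meson

lemma sort_rec_some:
  assumes "ascent n w i"
  obtains k where "ascent n w k" "sort_rec n D base w = D k (sort_rec n D base (swap_at w k))"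
  using assms someI[of "ascent n w" i] by (metis sort_rec.simps)

text \<open>
  Two different ascents can be joined: distant ones after one more step each, by the commutation relation, and adjacent
  ones after two more steps each, by the braid relation, since then three consecutive values increase and both
  ways lead to their reversal.
\<close>

lemma sort_rec_ascent:
  assumes comm: "\<And>i j f. Suc i < j \<Longrightarrow> D i (D j f) = D j (D i f)"
    and braid: "\<And>i f. D i (D (Suc i) (D i f)) = D (Suc i) (D i (D (Suc i) f))"
    and "ascent n w i"
  shows "sort_rec n D base w = D i (sort_rec n D base (swap_at w i))"
  using assms(3)
proof (induction "n * n - inversions n w" arbitrary: w i rule: less_induct)
  case less
  let ?V = "sort_rec n D base"
  have IH: "?V v = D j (?V (swap_at v j))" if "ascent n w k" "v = swap_at w k" "ascent n v j" for v j k
    using less.hyps[OF _ that(3)] swap_at_decreases[OF that(1)] that(2) by blast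
  have IH2: "?V v = D j (?V (swap_at v j))"
    if "ascent n w k" "ascent n (swap_at w k) l" "v = swap_at (swap_at w k) l" "ascent n v j" for v j k l
    using less.hyps[OF _ that(4)] swap_at_decreases[OF that(1)] swap_at_decreases[OF that(2)] that(3)
    by (meson less_trans)
  have *: "D i (?V (swap_at w i)) = D j (?V (swap_at w j))"
    if i: "ascent n w i" and j: "ascent n w j" and "i < j" for i j
  proof (cases "Suc i < j")
    case True
    have 1: "ascent n (swap_at w i) j" "ascent n (swap_at w j) i"
      using i j True by (auto simp: ascent_def transpose_def)
    have 2: "swap_at (swap_at w i) j = swap_at (swap_at w j) i"
      using True by (auto simp: transpose_def fun_eq_iff)
    have "?V (swap_at w i) = D j (?V (swap_at (swap_at w i) j))" using IH[OF i refl 1(1)] .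
    moreover have "?V (swap_at w j) = D i (?V (swap_at (swap_at w j) i))" using IH[OF j refl 1(2)] .
    ultimately show ?thesis using 2 comm[OF True] by simp
  next
    case False
    then have ji: "j = Suc i" using \<open>i < j\<close> by simp
    have 1: "ascent n (swap_at w i) j" "ascent n (swap_at w j) i"
      "ascent n (swap_at (swap_at w i) j) i" "ascent n (swap_at (swap_at w j) i) j"
      using i j ji by (auto simp: ascent_def transpose_def)
    have 2: "swap_at (swap_at (swap_at w i) j) i = swap_at (swap_at (swap_at w j) i) j"
      using ji by (auto simp: transpose_def fun_eq_iff)
    have "?V (swap_at w i) = D j (D i (?V (swap_at (swap_at (swap_at w i) j) i)))"
      using IH[OF i refl 1(1)] IH2[OF i 1(1) refl 1(3)] by simp
    moreover have "?V (swap_at w j) = D i (D j (?V (swap_at (swap_at (swap_at w j) i) j)))"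
      using IH[OF j refl 1(2)] IH2[OF j 1(2) refl 1(4)] by simp
    ultimately show ?thesis using 2 braid ji by simp
  qed
  obtain k where k: "ascent n w k" "?V w = D k (?V (swap_at w k))"
    using sort_rec_some[OF less.prems] by metis
  consider "k = i" | "k < i" | "i < k" by linarith
  then show ?case
  proof cases
    case 2
    then show ?thesis using *[OF k(1) less.prems] k(2) by simp
  next
    case 3
    then show ?thesis using *[OF less.prems k(1)] k(2) by simp
  qed (use k in simp)
qed

section \<open>Well-definedness of double Schubert polynomials\<close>

definition staircase :: "nat \<Rightarrow> double_poly" where
  "staircase n = (\<Prod>(i, j) \<in> {(i, j). 1 \<le> i \<and> 1 \<le> j \<and> i + j \<le> n}. X i - Const (X j))"

lemma longest_perm_permutes: "longest_perm n permutes {1..n}"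
proof -
  have "bij_betw (longest_perm n) {1..n} {1..n}"
    by (rule bij_betw_byWitness[where f' = "longest_perm n"]) (auto simp: longest_perm_def)
  then show ?thesis by (rule bij_imp_permutes) (auto simp: longest_perm_def)
qed

lemma no_ascent_longest_perm: "\<not> ascent n (longest_perm n) i"
  by (auto simp: ascent_def longest_perm_def)

lemma ascent_or_longest_perm:
  assumes w: "w permutes {1..n}" and no: "\<And>i. \<not> ascent n w i"
  shows "w = longest_perm n"
proof -
  have inj: "inj w" using w permutes_inj by blast
  have step: "w (Suc i) < w i" if "1 \<le> i" "i < n" for i
    using no[of i] that inj by (metis ascent_def injD n_not_Suc_n nat_neq_iff)
  have *: "w j + (j - i) \<le> w i" if "1 \<le> i" "i \<le> j" "j \<le> n" for i j
    using that(2,3)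
  proof (induction j rule: dec_induct)
    case (step j)
    then show ?case using \<open>\<And>i. 1 \<le> i \<Longrightarrow> i < n \<Longrightarrow> w (Suc i) < w i\<close>[of j] that(1) by simp
  qed simp
  have "w i = n + 1 - i" if "i \<in> {1..n}" for i
  proof -
    have "w 1 \<in> {1..n}" "w n \<in> {1..n}" using w that permutes_in_image[OF w] by auto
    then show ?thesis using *[of 1 i] *[of i n] that by auto
  qed
  moreover have "w i = i" if "i \<notin> {1..n}" for i using w that by (simp add: permutes_not_in)
  ultimately show ?thesis by (auto simp: longest_perm_def fun_eq_iff)
qed

lemma swap_at_permutes:
  "w permutes {1..n} \<Longrightarrow> 1 \<le> i \<Longrightarrow> i < n \<Longrightarrow> swap_at w i permutes {1..n}"
  by (rule permutes_compose[OF permutes_swap_id]) auto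

definition schubert_rec :: "nat \<Rightarrow> (nat \<Rightarrow> nat) \<Rightarrow> double_poly" where
  "schubert_rec n = sort_rec n div_diff (\<lambda>_. staircase n)"

lemma schubert_rec_ascent:
  "ascent n w i \<Longrightarrow> schubert_rec n w = div_diff i (schubert_rec n (swap_at w i))"
  unfolding schubert_rec_def by (rule sort_rec_ascent) (auto intro: div_diff_commute div_diff_braid)

lemma schubert_rec_longest: "schubert_rec n (longest_perm n) = staircase n"
  by (simp add: schubert_rec_def sort_rec_base no_ascent_longest_perm)

lemma double_schubert_rel_unique:
  "double_schubert_rel n w f \<Longrightarrow> f = schubert_rec n w"
proof (induction rule: double_schubert_rel.induct)
  case longest
  then show ?case by (simp add: schubert_rec_longest staircase_def)
next
  case (descend w i f)
  then have "ascent n w i" using ascentI_inversions by blast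
  then show ?case
    using descend.IH schubert_rec_ascent by metis
qed

lemma double_schubert_rel_exists:
  "w permutes {1..n} \<Longrightarrow> double_schubert_rel n w (schubert_rec n w)"
proof (induction "n * n - inversions n w" arbitrary: w rule: less_induct)
  case less
  show ?case
  proof (cases "\<exists>i. ascent n w i")
    case True
    then obtain i where i: "ascent n w i" by blast
    have "double_schubert_rel n (swap_at w i) (schubert_rec n (swap_at w i))"
      using less i swap_at_decreases swap_at_permutes ascent_def by blast
    then show ?thesis
      using schubert_rec_ascent[OF i] i
        double_schubert_rel.descend[OF less.prems _ _ _ _] inversions_swap_ascent[OF i]
      by (metis ascent_def lessI)
  next
    case False
    then have "w = longest_perm n" using ascent_or_longest_perm less.prems by blast
    then show ?thesis
      using double_schubert_rel.longest[of n] by (simp add: schubert_rec_longest staircase_def)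
  qed
qed

lemma double_schubert_eq:
  assumes "w permutes {1..n}"
  shows "double_schubert n w = schubert_rec n w"
  unfolding double_schubert_def
  using double_schubert_rel_exists[OF assms] double_schubert_rel_unique by (rule the_equality)

lemma double_schubert_longest: "double_schubert n (longest_perm n) = staircase n"
  by (simp only: double_schubert_eq[OF longest_perm_permutes] schubert_rec_longest)

lemma double_schubert_ascent:
  assumes "w permutes {1..n}" "ascent n w i"
  shows "double_schubert n w = div_diff i (double_schubert n (swap_at w i))"
  using assms schubert_rec_ascent[OF assms(2)] double_schubert_eq swap_at_permutes[OF assms(1)]
  by (metis ascent_def)

section \<open>Well-definedness of Lascoux polynomials\<close>

definition dominant :: "nat \<Rightarrow> (nat \<Rightarrow>\<^sub>0 nat) \<Rightarrow> bool" where
  "dominant n \<alpha> \<longleftrightarrow> \<alpha> \<in> compositions n \<and>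
    (\<forall>i. 1 \<le> i \<longrightarrow> i < n \<longrightarrow> Poly_Mapping.lookup \<alpha> (Suc i) \<le> Poly_Mapping.lookup \<alpha> i)"

lemma lookup_swap_parts: "Poly_Mapping.lookup (swap_parts i \<alpha>) = swap_at (Poly_Mapping.lookup \<alpha>) i"
  by (simp add: swap_parts_def map_key.rep_eq)

lemma compositions_iff:
  "\<alpha> \<in> compositions n \<longleftrightarrow> (\<forall>i. i \<notin> {1..n} \<longrightarrow> Poly_Mapping.lookup \<alpha> i = 0)"
  by (auto simp: compositions_def in_keys_iff subset_iff)

lemma swap_parts_compositions:
  assumes "\<alpha> \<in> compositions n" "1 \<le> i" "i < n"
  shows "swap_parts i \<alpha> \<in> compositions n"
  unfolding compositions_iff
proof (intro allI impI)
  fix k assume "k \<notin> {1..n}"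
  then show "Poly_Mapping.lookup (swap_parts i \<alpha>) k = 0"
    using assms by (cases "k = i"; cases "k = Suc i") (auto simp: lookup_swap_parts compositions_iff transpose_def)
qed

lemma total_degree_compositions:
  "\<alpha> \<in> compositions n \<Longrightarrow> total_degree \<alpha> = (\<Sum>i=1..n. Poly_Mapping.lookup \<alpha> i)"
  unfolding total_degree_def compositions_def
  by (rule sum.mono_neutral_left) (auto simp: in_keys_iff)

lemma total_degree_swap_parts:
  assumes "\<alpha> \<in> compositions n" "1 \<le> i" "i < n"
  shows "total_degree (swap_parts i \<alpha>) = total_degree \<alpha>"
proof -
  have "transpose i (Suc i) permutes {1..n}" by (rule permutes_swap_id) (use assms in auto)
  from sum.permute[OF this, of "Poly_Mapping.lookup \<alpha>"] show ?thesis
    by (simp only: total_degree_compositions[OF assms(1)]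
      total_degree_compositions[OF swap_parts_compositions[OF assms]] lookup_swap_parts)
qed

definition lascoux_rec :: "nat \<Rightarrow> (nat \<Rightarrow> nat) \<Rightarrow> int mpoly" where
  "lascoux_rec n = sort_rec n pi_bar (\<lambda>w. Poly_Mapping.single (Abs_poly_mapping w) 1)"

lemma lascoux_rec_ascent:
  "ascent n w i \<Longrightarrow> lascoux_rec n w = pi_bar i (lascoux_rec n (swap_at w i))"
  unfolding lascoux_rec_def by (rule sort_rec_ascent) (auto intro: pi_bar_commute pi_bar_braid)

lemma lascoux_rec_dominant:
  "dominant n \<alpha> \<Longrightarrow> lascoux_rec n (Poly_Mapping.lookup \<alpha>) = Poly_Mapping.single \<alpha> 1"
  unfolding lascoux_rec_def
  by (subst sort_rec_base) (auto simp: dominant_def ascent_def lookup_inverse leD)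

lemma lascoux_rel_unique:
  "lascoux_rel n \<alpha> f \<Longrightarrow> f = lascoux_rec n (Poly_Mapping.lookup \<alpha>)"
proof (induction rule: lascoux_rel.induct)
  case (dominant \<alpha>)
  then show ?case by (simp add: lascoux_rec_dominant dominant_def)
next
  case (ascend \<alpha> i f)
  then show ?case
    using lascoux_rec_ascent[of n "Poly_Mapping.lookup \<alpha>" i] by (simp only: lookup_swap_parts ascent_def simp_thms)
qed

lemma lascoux_rel_exists:
  "\<alpha> \<in> compositions n \<Longrightarrow> lascoux_rel n \<alpha> (lascoux_rec n (Poly_Mapping.lookup \<alpha>))"
proof (induction "n * n - inversions n (Poly_Mapping.lookup \<alpha>)" arbitrary: \<alpha> rule: less_induct)
  case less
  show ?case
  proof (cases "dominant n \<alpha>")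
    case True
    then show ?thesis using lascoux_rel.dominant[of \<alpha> n]
      by (simp add: lascoux_rec_dominant) (simp add: dominant_def)
  next
    case False
    then obtain i where i: "ascent n (Poly_Mapping.lookup \<alpha>) i"
      using less.prems by (auto simp: dominant_def ascent_def not_le)
    then have "lascoux_rel n (swap_parts i \<alpha>) (lascoux_rec n (Poly_Mapping.lookup (swap_parts i \<alpha>)))"
      using less.hyps[of "swap_parts i \<alpha>"] swap_at_decreases[OF i] swap_parts_compositions[OF less.prems, of i]
      by (simp only: lookup_swap_parts ascent_def simp_thms)
    then show ?thesis
      using lascoux_rel.ascend[OF less.prems, of i] lascoux_rec_ascent[OF i] i
      by (simp only: ascent_def lookup_swap_parts simp_thms)
  qed
qed

lemma lascoux_eq:
  assumes "\<alpha> \<in> compositions n"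
  shows "lascoux n \<alpha> = lascoux_rec n (Poly_Mapping.lookup \<alpha>)"
  unfolding lascoux_def using lascoux_rel_exists[OF assms] lascoux_rel_unique by (rule the_equality)

lemma lascoux_dominant: "dominant n \<alpha> \<Longrightarrow> lascoux n \<alpha> = Poly_Mapping.single \<alpha> 1"
  by (simp add: lascoux_eq lascoux_rec_dominant dominant_def)

lemma lascoux_ascent:
  "\<alpha> \<in> compositions n \<Longrightarrow> ascent n (Poly_Mapping.lookup \<alpha>) i \<Longrightarrow>
    lascoux n \<alpha> = pi_bar i (lascoux n (swap_parts i \<alpha>))"
  using lascoux_rec_ascent[of n "Poly_Mapping.lookup \<alpha>" i] swap_parts_compositions[of \<alpha> n i]
  by (simp only: lascoux_eq ascent_def lookup_swap_parts simp_thms)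

lemma monomial_symmetric:
  fixes c :: "'a::comm_ring_1"
  assumes "Poly_Mapping.lookup m i = Poly_Mapping.lookup m (Suc i)"
  shows "swap_vars i (Poly_Mapping.single m c) = Poly_Mapping.single m c"
proof -
  let ?t = "transpose i (Suc i)"
  let ?A = "Poly_Mapping.keys m \<union> {i, Suc i}"
  have lt: "Poly_Mapping.lookup m (?t j) = Poly_Mapping.lookup m j" for j
    using assms by (auto simp: transpose_def)
  have "monomial_at (\<lambda>j. X (?t j) :: 'a mpoly) m = (\<Prod>j\<in>?A. X (?t j) ^ Poly_Mapping.lookup m (?t j))"
    by (subst monomial_at_superset[of ?A]) (auto simp: lt)
  also have "\<dots> = (\<Prod>j\<in>?A. X j ^ Poly_Mapping.lookup m j)"
    by (rule prod.reindex_bij_witness[of _ ?t ?t])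
      (auto simp: in_keys_iff lt) 
  also have "\<dots> = monomial_at X m" by (subst monomial_at_superset[of ?A]) auto
  finally have "swap_vars i (Poly_Mapping.single m c) = eval Const X (Poly_Mapping.single m c)"
    by (simp add: swap_vars_def eval_single ring_hom_Const)
  then show ?thesis by (simp add: eval_Const_X)
qed

text \<open>
  By induction along the recursion: an ascent away from \<open>i\<close> commutes with the operator. If the ascent is next to \<open>i\<close>,
  the parts involved have the pattern \<open>(p, p, q)\<close> or \<open>(p, q, q)\<close>. Two steps of the recursion then move the equal
  parts to the other pair of positions, and the braid relation carries the operator there.
\<close>

lemma pi_bar_lascoux_equal:
  assumes "\<alpha> \<in> compositions n" "1 \<le> i" "i < n"
    "Poly_Mapping.lookup \<alpha> i = Poly_Mapping.lookup \<alpha> (Suc i)"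
  shows "pi_bar i (lascoux n \<alpha>) = lascoux n \<alpha>"
  using assms
proof (induction "n * n - inversions n (Poly_Mapping.lookup \<alpha>)" arbitrary: \<alpha> i rule: less_induct)
  case less
  let ?l = "Poly_Mapping.lookup"
  have step: "lascoux n \<beta> = pi_bar j (lascoux n (swap_parts j \<beta>))"
    "n * n - inversions n (?l (swap_parts j \<beta>)) < n * n - inversions n (?l \<beta>)"
    "swap_parts j \<beta> \<in> compositions n"
    if "ascent n (?l \<beta>) j" "\<beta> \<in> compositions n" for j \<beta>
    using that lascoux_ascent swap_at_decreases[OF that(1)] swap_parts_compositions
    by (auto simp: lookup_swap_parts ascent_def)
  show ?case
  proof (cases "dominant n \<alpha>")
    case True
    then show ?thesis using less.prems
      by (simp add: lascoux_dominant monomial_symmetric pi_bar_symmetric)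
  next
    case False
    then obtain j where j: "ascent n (?l \<alpha>) j"
      using less.prems by (auto simp: dominant_def ascent_def not_le)
    note j' = step[OF j less.prems(1)]
    consider "Suc i < j" | "Suc j < i" | "j = Suc i" | "i = Suc j"
      using j less.prems(4) by (metis Suc_lessI ascent_def less_irrefl nat_neq_iff)
    then show ?thesis
    proof cases
      case 1
      then have "pi_bar i (lascoux n (swap_parts j \<alpha>)) = lascoux n (swap_parts j \<alpha>)"
        using less.prems by (intro less.hyps[OF j'(2,3)]) (auto simp: lookup_swap_parts transpose_def)
      then show ?thesis using j'(1) pi_bar_commute[OF 1] by metis
    next
      case 2
      then have "pi_bar i (lascoux n (swap_parts j \<alpha>)) = lascoux n (swap_parts j \<alpha>)"
        using less.prems by (intro less.hyps[OF j'(2,3)]) (auto simp: lookup_swap_parts transpose_def)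
      then show ?thesis using j'(1) pi_bar_commute[OF 2] by metis
    next
      case 3
      let ?\<beta> = "swap_parts j \<alpha>"
      let ?\<gamma> = "swap_parts i ?\<beta>"
      have i: "ascent n (?l ?\<beta>) i"
        using j less.prems 3 by (auto simp: ascent_def lookup_swap_parts transpose_def)
      note i' = step[OF i j'(3)]
      have "pi_bar j (lascoux n ?\<gamma>) = lascoux n ?\<gamma>"
        by (rule less.hyps) (use i' j' j less.prems 3 in \<open>auto simp: ascent_def lookup_swap_parts transpose_def\<close>)
      then show ?thesis using i'(1) j'(1) 3 pi_bar_braid[of i "lascoux n ?\<gamma>"] by simp
    next
      case 4
      let ?\<beta> = "swap_parts j \<alpha>"
      let ?\<gamma> = "swap_parts i ?\<beta>"
      have i: "ascent n (?l ?\<beta>) i"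
        using j less.prems 4 by (auto simp: ascent_def lookup_swap_parts transpose_def)
      note i' = step[OF i j'(3)]
      have "pi_bar j (lascoux n ?\<gamma>) = lascoux n ?\<gamma>"
        by (rule less.hyps) (use i' j' j less.prems 4 in \<open>auto simp: ascent_def lookup_swap_parts transpose_def\<close>)
      then show ?thesis using i'(1) j'(1) 4 pi_bar_braid[of j "lascoux n ?\<gamma>"] by simp
    qed
  qed
qed

text \<open>
  The operator \<open>pi_bar i\<close> sorts the parts \<open>i\<close>, \<open>i + 1\<close> into increasing order; parts already in that order are
  left alone, by idempotence or by the preceding lemma.
\<close>

lemma pi_bar_lascoux:
  assumes "\<alpha> \<in> compositions n" "1 \<le> i" "i < n"
  obtains \<beta> where "\<beta> \<in> compositions n" "total_degree \<beta> = total_degree \<alpha>"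
    "pi_bar i (lascoux n \<alpha>) = lascoux n \<beta>"
proof -
  let ?l = "Poly_Mapping.lookup"
  consider "?l \<alpha> i < ?l \<alpha> (Suc i)" | "?l \<alpha> i = ?l \<alpha> (Suc i)" | "?l \<alpha> (Suc i) < ?l \<alpha> i" by linarith
  then show ?thesis
  proof cases
    case 1
    then have "ascent n (?l \<alpha>) i" using assms by (simp add: ascent_def)
    then have "pi_bar i (lascoux n \<alpha>) = lascoux n \<alpha>"
      using lascoux_ascent[OF assms(1)] pi_bar_idem by metis
    then show ?thesis using that assms(1) by blast
  next
    case 2
    then show ?thesis using that pi_bar_lascoux_equal assms by blast
  next
    case 3
    let ?\<beta> = "swap_parts i \<alpha>"
    have "ascent n (?l ?\<beta>) i" using 3 assms by (simp add: ascent_def lookup_swap_parts)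
    moreover have "swap_parts i ?\<beta> = \<alpha>"
      by (rule poly_mapping_eqI) (simp add: lookup_swap_parts)
    ultimately have "lascoux n ?\<beta> = pi_bar i (lascoux n \<alpha>)"
      using lascoux_ascent[of ?\<beta> n i] swap_parts_compositions[OF assms] by simp
    then show ?thesis
      using that[of ?\<beta>] swap_parts_compositions[OF assms] total_degree_swap_parts[OF assms] by simp
  qed
qed

lemma pi_bar_word_dominant:
  assumes "dominant n \<mu>" "set us \<subseteq> {1..<n}"
  obtains \<alpha> where "\<alpha> \<in> compositions n" "total_degree \<alpha> = total_degree \<mu>"
    "foldr pi_bar us (Poly_Mapping.single \<mu> 1) = lascoux n \<alpha>"
proof -
  have "\<exists>\<alpha>\<in>compositions n. total_degree \<alpha> = total_degree \<mu> \<and>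
      foldr pi_bar us (Poly_Mapping.single \<mu> 1) = lascoux n \<alpha>"
    using assms(2)
  proof (induction us)
    case Nil
    then show ?case using assms(1) lascoux_dominant[OF assms(1)] by (auto simp: dominant_def)
  next
    case (Cons i us)
    then obtain \<alpha> where \<alpha>: "\<alpha> \<in> compositions n" "total_degree \<alpha> = total_degree \<mu>"
      "foldr pi_bar us (Poly_Mapping.single \<mu> 1) = lascoux n \<alpha>" by auto
    have "1 \<le> i" "i < n" using Cons.prems by auto
    from pi_bar_lascoux[OF \<alpha>(1) this] show ?case using \<alpha> by (metis foldr_Cons comp_apply)
  qed
  then show ?thesis using that by blast
qed

section \<open>Reflected Schubert polynomials\<close>

lemma ring_hom_int: "ring_hom \<phi> \<Longrightarrow> \<phi> (k::int) = of_int k"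
  by (induction k rule: int_induct[where k = 0]) (auto simp: ring_hom_simps)

lemma ring_hom_eval_apply:
  assumes "ring_hom \<phi>" "ring_hom \<psi>"
  shows "\<psi> (eval \<phi> v f) = eval (\<lambda>c. \<psi> (\<phi> c)) (\<lambda>i. \<psi> (v i)) f"
proof -
  have c: "ring_hom (\<lambda>c. \<psi> (\<phi> c))"
    using assms by (simp add: ring_hom_def)
  show ?thesis
    by (induction f rule: mpoly_induct)
      (simp_all add: eval_single eval_add c assms ring_hom_simps[OF assms(2)] ring_hom_monomial_at[OF assms])
qed

lemma ring_hom_to_fract: "ring_hom to_fract"
  by (simp add: ring_hom_def)

lemma eval_to_fract_X: "eval of_int (\<lambda>i. to_fract (X i)) F = to_fract (F :: int mpoly)"
proof -
  have "to_fract F = to_fract (eval Const X F)" by (simp add: eval_Const_X)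
  also have "\<dots> = eval (\<lambda>c. to_fract (Const c)) (\<lambda>i. to_fract (X i)) F"
    by (rule ring_hom_eval_apply[OF ring_hom_Const ring_hom_to_fract])
  also have "(\<lambda>c::int. to_fract (Const c :: int mpoly)) = of_int"
    by (rule ext, rule ring_hom_int) (simp add: ring_hom_def ring_hom_simps[OF ring_hom_Const])
  finally show ?thesis by simp
qed

text \<open>
  The contribution to the reflected polynomial of a column \<open>{1..a}\<close> of the diagram: row \<open>i\<close> corresponds to the
  variable \<open>X (n + 1 - i)\<close>, so a column of height \<open>a\<close> occupies the last \<open>a\<close> variables. A box gives
  \<open>x (1/x - 1) = 1 - x\<close>, and an empty cell gives \<open>x\<close>.
\<close>

definition column_factor :: "nat \<Rightarrow> nat \<Rightarrow> int mpoly" where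
  "column_factor n a = (\<Prod>k=1..n - a. X k) * (\<Prod>k=n - a + 1..n. 1 - X k)"

text \<open>
  The divided difference in the variables \<open>1/x\<^sub>k\<close>, \<open>1/x\<^bsub>k+1\<^esub>\<close>.
\<close>

definition co_diff :: "nat \<Rightarrow> int mpoly \<Rightarrow> int mpoly" where
  "co_diff k F = X k * X (Suc k) * div_diff k F"

abbreviation reflected :: "nat \<Rightarrow> (nat \<Rightarrow> int mpoly fract) \<Rightarrow> nat \<Rightarrow> int mpoly fract" where
  "reflected n x \<equiv> \<lambda>i. inverse (x (n + 1 - i))"

text \<open>
  The relation is tested at all injective families of nonzero points, and not only at the variables themselves, because
  the inductive step has to exchange two points; injectivity allows division by \<open>x k - x (Suc k)\<close>.
\<close>

definition reflects :: "nat \<Rightarrow> double_poly \<Rightarrow> int mpoly \<Rightarrow> bool" where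
  "reflects n f F \<longleftrightarrow> (\<forall>x :: nat \<Rightarrow> int mpoly fract. inj x \<longrightarrow> (\<forall>k. x k \<noteq> 0) \<longrightarrow>
    eval of_int x F = (\<Prod>k=1..n. x k ^ n) * eval_double (reflected n x) (\<lambda>_. 1) f)"

lemma ring_hom_eval_double: "ring_hom (eval_double u v)"
  unfolding eval_double_def by (intro ring_hom_eval ring_hom_of_int)

lemma eval_double_X: "eval_double u v (X i) = u i"
  by (simp add: eval_double_def eval_X ring_hom_eval ring_hom_of_int)

lemma eval_double_Const: "eval_double u v (Const c) = eval of_int v c"
  by (simp add: eval_double_def eval_Const ring_hom_eval ring_hom_of_int)

text \<open>
  At the points \<open>x\<close>, with \<open>k = n - i\<close>, the difference of the two variables of \<open>f\<close> is
  \<open>1/x\<^bsub>k+1\<^esub> - 1/x\<^sub>k = (x\<^sub>k - x\<^bsub>k+1\<^esub>) / (x\<^sub>k x\<^bsub>k+1\<^esub>)\<close>, which explains the factor \<open>x\<^sub>k x\<^bsub>k+1\<^esub>\<close> in \<open>co_diff\<close>.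
  The prefactor \<open>\<Prod>x\<^sub>k\<^sup>n\<close> is symmetric and passes through.
\<close>

lemma reflects_div_diff:
  assumes f: "reflects n f F" and i: "1 \<le> i" "i < n"
  shows "reflects n (div_diff i f) (co_diff (n - i) F)"
  unfolding reflects_def
proof (intro allI impI)
  fix x :: "nat \<Rightarrow> int mpoly fract" assume x: "inj x" "\<forall>k. x k \<noteq> 0"
  define k where "k = n - i"
  define x' where "x' = x \<circ> transpose k (Suc k)"
  let ?R = "eval_double (reflected n x) (\<lambda>_. 1)"
  let ?e = "eval of_int x :: int mpoly \<Rightarrow> int mpoly fract"
  let ?P = "\<Prod>k=1..n. x k ^ n"
  note hom = ring_hom_simps[OF ring_hom_eval_double] ring_hom_simps[OF ring_hom_eval[OF ring_hom_of_int]]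
  have k: "1 \<le> k" "k < n" "n + 1 - i = Suc k" "n + 1 - Suc i = k" using i by (auto simp: k_def)
  have x': "inj x'" "\<forall>k. x' k \<noteq> 0"
    unfolding x'_def using x by (auto intro: inj_compose)
  have P': "(\<Prod>k=1..n. x' k ^ n) = ?P"
  proof -
    have "transpose k (Suc k) permutes {1..n}" by (rule permutes_swap_id) (use k in auto)
    from prod.permute[OF this, of "\<lambda>k. x k ^ n"] show ?thesis by (simp add: x'_def comp_def)
  qed
  have "reflected n x (transpose i (Suc i) j) = reflected n x' j" for j
  proof -
    have "n + 1 - transpose i (Suc i) j = transpose k (Suc k) (n + 1 - j)"
      using i by (auto simp: k_def transpose_def)
    then show ?thesis by (simp add: x'_def)
  qed
  then have swapR: "?R (swap_vars i f) = eval_double (reflected n x') (\<lambda>_. 1) f"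
    by (simp add: eval_double_def eval_swap_vars ring_hom_eval ring_hom_of_int)
  have swapF: "?e (swap_vars k F) = eval of_int x' F"
    by (simp add: eval_swap_vars ring_hom_of_int x'_def comp_def)
  have "?R (X i - X (Suc i)) * ?R (div_diff i f) = ?R f - ?R (swap_vars i f)"
    by (metis div_diff hom(4,6))
  then have 1: "(inverse (x (Suc k)) - inverse (x k)) * ?R (div_diff i f) = ?R f - ?R (swap_vars i f)"
    by (simp only: hom eval_double_X k)
  have "?e (X k - X (Suc k)) * ?e (div_diff k F) = ?e F - ?e (swap_vars k F)"
    by (metis div_diff hom(10,12))
  moreover have F: "eval of_int y F = (\<Prod>k=1..n. y k ^ n) * eval_double (reflected n y) (\<lambda>_. 1) f"
    if "inj y" "\<forall>k. y k \<noteq> 0" for y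
    using f that unfolding reflects_def by blast
  ultimately have "(x k - x (Suc k)) * ?e (div_diff k F) = ?P * (?R f - ?R (swap_vars i f))"
    by (simp only: hom eval_X[OF ring_hom_of_int] swapF swapR F[OF x] F[OF x'] P' right_diff_distrib)
  also have "\<dots> = ?P * ((inverse (x (Suc k)) - inverse (x k)) * ?R (div_diff i f))"
    by (simp only: 1)
  finally have "(x k - x (Suc k)) * (x k * x (Suc k) * ?e (div_diff k F))
      = (x k * x (Suc k) * (inverse (x (Suc k)) - inverse (x k))) * (?P * ?R (div_diff i f))"
    by (simp add: mult_ac)
  also have "x k * x (Suc k) * (inverse (x (Suc k)) - inverse (x k)) = x k - x (Suc k)"
    using x(2)[rule_format, of k] x(2)[rule_format, of "Suc k"] by (simp add: field_simps)
  finally have "x k * x (Suc k) * ?e (div_diff k F) = ?P * ?R (div_diff i f)"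
    using injD[OF x(1), of k "Suc k"] by auto
  then show "?e (co_diff (n - i) F) = ?P * ?R (div_diff i f)"
    by (simp add: co_diff_def hom eval_X ring_hom_of_int flip: k_def)
qed

lemma staircase_columns: "staircase n = (\<Prod>j=1..n. \<Prod>i=1..n - j. X i - Const (X j))"
proof -
  have "(\<Prod>j=1..n. \<Prod>i=1..n - j. X i - Const (X j) :: double_poly)
      = (\<Prod>(j, i)\<in>(SIGMA j:{1..n}. {1..n - j}). X i - Const (X j))"
    by (rule prod.Sigma) auto
  also have "\<dots> = staircase n"
    unfolding staircase_def
    by (rule prod.reindex_bij_witness[of _ prod.swap prod.swap]) auto
  finally show ?thesis by simp
qed

lemma reflects_staircase: "reflects n (staircase n) (\<Prod>j=1..n. column_factor n (n - j))"
  unfolding reflects_def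
proof (intro allI impI)
  fix x :: "nat \<Rightarrow> int mpoly fract" assume x: "inj x" "\<forall>k. x k \<noteq> 0"
  let ?R = "eval_double (reflected n x) (\<lambda>_. 1)"
  let ?e = "eval of_int x :: int mpoly \<Rightarrow> int mpoly fract"
  note hom = ring_hom_simps[OF ring_hom_eval_double] ring_hom_simps[OF ring_hom_eval[OF ring_hom_of_int]]
     ring_hom_prod[OF ring_hom_eval_double] ring_hom_prod[OF ring_hom_eval[OF ring_hom_of_int]]
  have col: "?e (column_factor n (n - j)) = (\<Prod>k=1..n. x k) * (\<Prod>i=1..n - j. reflected n x i - 1)"
    if "j \<in> {1..n}" for j
  proof -
    have "(\<Prod>i=1..n - j. reflected n x i - 1) = (\<Prod>k=j + 1..n. inverse (x k) - 1)"
      by (rule prod.reindex_bij_witness[of _ "\<lambda>k. n + 1 - k" "\<lambda>k. n + 1 - k"]) (use that in auto)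
    moreover have "(\<Prod>k=1..n. x k) = (\<Prod>k=1..j. x k) * (\<Prod>k=j + 1..n. x k)"
    proof -
      have "{1..n} = {1..j} \<union> {j + 1..n}" using that by auto
      then show ?thesis by (simp only:) (rule prod.union_disjoint, auto)
    qed
    ultimately have "(\<Prod>k=1..n. x k) * (\<Prod>i=1..n - j. reflected n x i - 1)
        = (\<Prod>k=1..j. x k) * (\<Prod>k=j + 1..n. x k * (inverse (x k) - 1))"
      by (simp add: prod.distrib mult.assoc)
    also have "(\<Prod>k=j + 1..n. x k * (inverse (x k) - 1)) = (\<Prod>k=j + 1..n. 1 - x k)"
      using x(2) by (intro prod.cong) (auto simp: right_diff_distrib)
    finally show ?thesis
      using that by (simp add: column_factor_def hom eval_X ring_hom_of_int)
  qed
  have "?e (\<Prod>j=1..n. column_factor n (n - j)) =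
      (\<Prod>j=1..n. (\<Prod>k=1..n. x k) * (\<Prod>i=1..n - j. reflected n x i - 1))"
    unfolding hom by (rule prod.cong) (use col in auto)
  also have "\<dots> = (\<Prod>k=1..n. x k ^ n) * (\<Prod>j=1..n. \<Prod>i=1..n - j. reflected n x i - 1)"
    by (simp add: prod.distrib prod_power_distrib)
  also have "(\<Prod>j=1..n. \<Prod>i=1..n - j. reflected n x i - 1) = ?R (staircase n)"
    unfolding staircase_columns hom
    by (simp add: eval_double_X eval_double_Const eval_X hom ring_hom_of_int)
  finally show "?e (\<Prod>j=1..n. column_factor n (n - j)) = (\<Prod>k=1..n. x k ^ n) * ?R (staircase n)" .
qed

lemma X_eq_iff: "(X i :: 'a::comm_ring_1 mpoly) = X j \<longleftrightarrow> i = j"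
proof
  assume "(X i :: 'a mpoly) = X j"
  then have "Poly_Mapping.lookup (X i :: 'a mpoly) (Poly_Mapping.single i 1) =
      Poly_Mapping.lookup (X j) (Poly_Mapping.single i 1)" by simp
  then have "Poly_Mapping.single j (1::nat) = Poly_Mapping.single i 1"
    by (auto simp: X_def lookup_single when_def split: if_splits)
  then show "i = j" by (metis lookup_single_eq lookup_single_not_eq zero_neq_one)
qed simp

lemma X_nonzero: "(X i :: 'a::comm_ring_1 mpoly) \<noteq> 0"
  by (metis X_def lookup_single_eq lookup_zero zero_neq_one)

lemma reflects_to_fract:
  assumes "reflects n f F"
  shows "to_fract F = (\<Prod>i=1..n. to_fract (X i) ^ n) *
      eval_double (\<lambda>i. inverse (to_fract (X (n + 1 - i)))) (\<lambda>j. 1) f"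
proof -
  have "inj (\<lambda>i. to_fract (X i :: int mpoly))"
    by (auto simp: inj_def X_eq_iff)
  moreover have "\<forall>k. to_fract (X k :: int mpoly) \<noteq> 0" by (simp add: X_nonzero)
  ultimately have "eval of_int (\<lambda>i. to_fract (X i)) F = (\<Prod>i=1..n. to_fract (X i) ^ n) *
      eval_double (reflected n (\<lambda>i. to_fract (X i))) (\<lambda>j. 1) f"
    using assms unfolding reflects_def by blast
  then show ?thesis by (simp only: eval_to_fract_X)
qed

definition co_schubert :: "nat \<Rightarrow> (nat \<Rightarrow> nat) \<Rightarrow> int mpoly" where
  "co_schubert n w = (THE F. reflects n (double_schubert n w) F)"

lemma co_schubertI: "reflects n (double_schubert n w) F \<Longrightarrow> co_schubert n w = F"
  unfolding co_schubert_def using reflects_to_fract by (intro the_equality) (auto, metis to_fract_eq_iff)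

lemma co_schubert_longest: "co_schubert n (longest_perm n) = (\<Prod>j=1..n. column_factor n (n - j))"
  using reflects_staircase by (intro co_schubertI) (simp add: double_schubert_longest)

lemma reflects_co_schubert:
  "w permutes {1..n} \<Longrightarrow> reflects n (double_schubert n w) (co_schubert n w)"
proof (induction "n * n - inversions n w" arbitrary: w rule: less_induct)
  case less
  show ?case
  proof (cases "\<exists>i. ascent n w i")
    case True
    then obtain i where i: "ascent n w i" by blast
    then have i': "1 \<le> i" "i < n" by (auto simp: ascent_def)
    have "reflects n (double_schubert n (swap_at w i)) (co_schubert n (swap_at w i))"
      using less.hyps[OF swap_at_decreases[OF i] swap_at_permutes[OF less.prems i']] .
    then have "reflects n (double_schubert n w) (co_diff (n - i) (co_schubert n (swap_at w i)))"
      using reflects_div_diff i' double_schubert_ascent[OF less.prems i] by simp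
    then show ?thesis using co_schubertI by metis
  next
    case False
    then have "w = longest_perm n" using ascent_or_longest_perm less.prems by blast
    then show ?thesis
      using reflects_staircase double_schubert_longest co_schubert_longest by simp
  qed
qed

lemma co_schubert_ascent:
  assumes "w permutes {1..n}" "ascent n w i"
  shows "co_schubert n w = co_diff (n - i) (co_schubert n (swap_at w i))"
  using assms reflects_div_diff[OF reflects_co_schubert[OF swap_at_permutes[OF assms(1)]], of i i]
  by (intro co_schubertI) (simp only: double_schubert_ascent ascent_def simp_thms)

section \<open>Order at the origin\<close>

definition order_ge :: "nat \<Rightarrow> 'a::comm_ring_1 mpoly \<Rightarrow> bool" where
  "order_ge d f \<longleftrightarrow> (\<forall>m\<in>Poly_Mapping.keys f. d \<le> total_degree m)"

lemma total_degree_superset: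
  "finite A \<Longrightarrow> Poly_Mapping.keys m \<subseteq> A \<Longrightarrow> total_degree m = (\<Sum>i\<in>A. Poly_Mapping.lookup m i)"
  unfolding total_degree_def by (rule sum.mono_neutral_left) (auto simp: in_keys_iff)

lemma total_degree_add: "total_degree (m + m') = total_degree m + total_degree m'"
  using total_degree_superset[of "Poly_Mapping.keys m \<union> Poly_Mapping.keys m'"] keys_add[of m m']
  by (simp add: lookup_add sum.distrib)

lemma total_degree_single: "total_degree (Poly_Mapping.single i k) = k"
  using total_degree_superset[of "{i}" "Poly_Mapping.single i k"] by simp

lemma order_ge_0 [simp]: "order_ge d 0" "order_ge 0 f"
  by (auto simp: order_ge_def)

lemma order_ge_add: "order_ge d f \<Longrightarrow> order_ge d g \<Longrightarrow> order_ge d (f + g)"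
  using keys_add[of f g] by (auto simp: order_ge_def)

lemma order_ge_minus: "order_ge d f \<Longrightarrow> order_ge d (- f)"
  by (simp add: order_ge_def)

lemma order_ge_sum: "(\<And>i. i \<in> A \<Longrightarrow> order_ge d (f i)) \<Longrightarrow> order_ge d (sum f A)"
  by (induction A rule: infinite_finite_induct) (auto intro: order_ge_add)

lemma order_ge_mult: "order_ge d f \<Longrightarrow> order_ge e g \<Longrightarrow> order_ge (d + e) (f * g)"
  using keys_mult[of f g] by (force simp: order_ge_def total_degree_add intro: add_mono)

lemma order_ge_X: "order_ge 1 (X i)"
  by (simp add: order_ge_def X_def total_degree_single)

lemma order_ge_single: "order_ge (total_degree m) (Poly_Mapping.single m c)"
  by (simp add: order_ge_def)

lemma order_ge_mono: "order_ge d f \<Longrightarrow> e \<le> d \<Longrightarrow> order_ge e f"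
  by (auto simp: order_ge_def)

text \<open>
  By the Leibniz rule in the form of \<open>div_diff_X_mult\<close>, removing one variable from the monomial at a time.
\<close>

lemma order_ge_div_diff_single:
  "order_ge (total_degree m - 1) (div_diff i (Poly_Mapping.single m (c::'a::idom)))"
proof (induction "total_degree m" arbitrary: m)
  case 0
  then show ?case by simp
next
  case (Suc d)
  then obtain j where j: "j \<in> Poly_Mapping.keys m"
    unfolding total_degree_def by (metis sum.empty equals0I nat.distinct(1))
  define m' where "m' = m - Poly_Mapping.single j 1"
  have m: "m = Poly_Mapping.single j 1 + m'"
    by (rule poly_mapping_eqI)
      (use j in \<open>auto simp: m'_def lookup_add lookup_minus lookup_single when_def in_keys_iff\<close>)
  then have d: "d = total_degree m'" using Suc(2) by (simp add: total_degree_add total_degree_single)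
  let ?g = "Poly_Mapping.single m' c"
  have "Poly_Mapping.single m c = X j * ?g" by (simp add: m X_def mult_single)
  moreover have "order_ge d (X (transpose i (Suc i) j) * div_diff i ?g)"
    using order_ge_mult[OF order_ge_X Suc(1)[OF d], of "transpose i (Suc i) j"] d
    by (auto intro: order_ge_mono)
  moreover have "order_ge d (if j = i then ?g else if j = Suc i then - ?g else 0)"
    using d order_ge_single[of m' c] by (auto intro: order_ge_minus)
  moreover have "total_degree m - 1 = d" using Suc(2) by simp
  ultimately show ?case by (simp only: div_diff_X_mult order_ge_add)
qed

lemma div_diff_sum: "div_diff i (sum f A) = (\<Sum>a\<in>A. div_diff i (f a))"
  by (induction A rule: infinite_finite_induct) (auto simp: div_diff_add)

lemma order_ge_div_diff:
  assumes "order_ge (Suc d) f"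
  shows "order_ge d (div_diff i f)"
proof -
  have "div_diff i f = (\<Sum>m\<in>Poly_Mapping.keys f. div_diff i (Poly_Mapping.single m (Poly_Mapping.lookup f m)))"
    by (subst div_diff_sum[symmetric]) (simp add: poly_mapping_sum_single)
  also have "order_ge d \<dots>"
  proof (rule order_ge_sum)
    fix m assume "m \<in> Poly_Mapping.keys f"
    then have "d \<le> total_degree m - 1" using assms by (auto simp: order_ge_def)
    then show "order_ge d (div_diff i (Poly_Mapping.single m (Poly_Mapping.lookup f m)))"
      using order_ge_div_diff_single order_ge_mono by blast
  qed
  finally show ?thesis .
qed

lemma order_ge_co_diff:
  assumes "order_ge d f"
  shows "order_ge (Suc d) (co_diff k f)"
proof -
  have "order_ge (d - 1) (div_diff k f)"
    using assms by (cases d) (simp_all add: order_ge_div_diff)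
  then have "order_ge (1 + 1 + (d - 1)) (co_diff k f)"
    unfolding co_diff_def by (intro order_ge_mult order_ge_X)
  then show ?thesis by (rule order_ge_mono) simp
qed

lemma order_ge_prod: "finite A \<Longrightarrow> (\<And>i. i \<in> A \<Longrightarrow> order_ge (d i) (f i)) \<Longrightarrow> order_ge (sum d A) (prod f A)"
  by (induction A rule: finite_induct) (auto intro: order_ge_mult)

section \<open>Column factors and words of operators\<close>

lemma foldr_pi_bar_symmetric_mult:
  "(\<And>k. k \<in> set us \<Longrightarrow> swap_vars k p = p) \<Longrightarrow> foldr pi_bar us (p * f) = p * foldr pi_bar us f"
  by (induction us) (auto simp: pi_bar_symmetric_mult)

lemma foldr_pi_bar_commute:
  "(\<And>j. j \<in> set us \<Longrightarrow> Suc j < k \<or> Suc k < j) \<Longrightarrow> pi_bar k (foldr pi_bar us f) = foldr pi_bar us (pi_bar k f)"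
proof (induction us)
  case (Cons j us)
  then show ?case using pi_bar_commute[of j k] pi_bar_commute[of k j] by (metis comp_apply foldr_Cons list.set_intros)
qed simp

lemma swap_vars_prod_closed:
  assumes "i \<in> A \<longleftrightarrow> Suc i \<in> A"
  shows "swap_vars i (\<Prod>j\<in>A. h (X j)) = (\<Prod>j\<in>A. swap_vars i (h (X (transpose i (Suc i) j))))"
  unfolding ring_hom_prod[OF ring_hom_swap_vars]
  by (rule prod.reindex_bij_witness[of _ "transpose i (Suc i)" "transpose i (Suc i)"])
    (use assms in \<open>auto simp: transpose_def\<close>)

lemma swap_vars_prod_X:
  "(i \<in> A \<longleftrightarrow> Suc i \<in> A) \<Longrightarrow> swap_vars i (\<Prod>j\<in>A. X j) = (\<Prod>j\<in>A. X j)"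
  using swap_vars_prod_closed[of i A "\<lambda>x. x"] by simp

lemma swap_vars_prod_1_minus_X:
  "(i \<in> A \<longleftrightarrow> Suc i \<in> A) \<Longrightarrow> swap_vars i (\<Prod>j\<in>A. 1 - X j) = (\<Prod>j\<in>A. 1 - X j)"
  using swap_vars_prod_closed[of i A "\<lambda>x. 1 - x"] by simp

lemma swap_vars_column_factor:
  assumes "1 \<le> k" "k < n" "k \<noteq> n - a"
  shows "swap_vars k (column_factor n a) = column_factor n a"
proof -
  have "swap_vars k (\<Prod>k=1..n - a. X k :: int mpoly) = (\<Prod>k=1..n - a. X k)"
    by (rule swap_vars_prod_X) (use assms in auto)
  moreover have "swap_vars k (\<Prod>k=n - a + 1..n. 1 - X k :: int mpoly) = (\<Prod>k=n - a + 1..n. 1 - X k)"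
    by (rule swap_vars_prod_1_minus_X) (use assms in auto)
  ultimately show ?thesis by (simp only: column_factor_def swap_vars_simps)
qed

lemma swap_vars_prod_invariant:
  "(\<And>j. j \<in> A \<Longrightarrow> swap_vars k (f j) = f j) \<Longrightarrow> swap_vars k (prod f A) = prod f A"
  by (simp add: ring_hom_prod[OF ring_hom_swap_vars])

text \<open>
  With \<open>k = n - i\<close> one has \<open>c\<^sub>i = x\<^sub>k (1 - x\<^bsub>k+1\<^esub>) h\<close> with \<open>h\<close> symmetric in \<open>x\<^sub>k, x\<^bsub>k+1\<^esub>\<close>. The first two factors are
  exactly those in the definition of \<open>pi_bar k\<close>, and \<open>x\<^sub>k x\<^bsub>k+1\<^esub> h = c\<^bsub>i-1\<^esub>\<close>.
\<close>

lemma co_diff_column_factor: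
  assumes "1 \<le> i" "i < n"
  shows "co_diff (n - i) (column_factor n i * H) = column_factor n (i - 1) * pi_bar (n - i) H"
proof -
  define k where "k = n - i"
  have k: "1 \<le> k" "k < n" "n - i = k" "n - (i - 1) = Suc k" using assms by (auto simp: k_def)
  define h :: "int mpoly" where "h = (\<Prod>k=1..k - 1. X k) * (\<Prod>k=k + 2..n. 1 - X k)"
  have sets: "{1..k} = insert k {1..k - 1}" "{k + 1..n} = insert (Suc k) {k + 2..n}"
    "{1..Suc k} = insert (Suc k) {1..k}" "{Suc k + 1..n} = {k + 2..n}" using k by auto
  have p1: "(\<Prod>j=1..k. X j :: int mpoly) = X k * (\<Prod>j=1..k - 1. X j)"
    by (subst sets(1), rule prod.insert) (use k in auto)
  have p2: "(\<Prod>j=1..Suc k. X j :: int mpoly) = X (Suc k) * (\<Prod>j=1..k. X j)"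
    by (subst sets(3), rule prod.insert) auto
  have p3: "(\<Prod>j=k + 1..n. 1 - X j :: int mpoly) = (1 - X (Suc k)) * (\<Prod>j=k + 2..n. 1 - X j)"
    by (subst sets(2), rule prod.insert) auto
  have cf: "column_factor n i = h * (X k * (1 - X (Suc k)))" "column_factor n (i - 1) = h * (X k * X (Suc k))"
    unfolding column_factor_def k p2 p1 p3 sets(4) h_def by (simp_all only: mult_ac)
  have "swap_vars k (\<Prod>k=1..k - 1. X k :: int mpoly) = (\<Prod>k=1..k - 1. X k)"
    by (rule swap_vars_prod_X) (use k in auto)
  moreover have "swap_vars k (\<Prod>k=k + 2..n. 1 - X k :: int mpoly) = (\<Prod>k=k + 2..n. 1 - X k)"
    by (rule swap_vars_prod_1_minus_X) (use k in auto)
  ultimately have "swap_vars k h = h" by (simp only: h_def swap_vars_simps)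
  then have "div_diff k (h * (X k * (1 - X (Suc k)) * H)) = h * pi_bar k H"
    by (simp only: div_diff_symmetric_mult pi_bar_alt)
  then have "div_diff k (column_factor n i * H) = h * pi_bar k H" by (simp only: cf mult.assoc)
  then show ?thesis by (simp only: co_diff_def k(3) cf(2) mult_ac)
qed

section \<open>Columns of the Rothe diagram\<close>

text \<open>
  The columns of the Rothe diagram, indexed by values: \<open>inv w j\<close> is the row that contains the dot of column \<open>j\<close>.
\<close>

definition column :: "nat \<Rightarrow> (nat \<Rightarrow> nat) \<Rightarrow> nat \<Rightarrow> nat set" where
  "column n w j = {r \<in> {1..n}. r < inv w j \<and> j < w r}"

definition comparable :: "'a set \<Rightarrow> 'a set \<Rightarrow> bool" where
  "comparable A B \<longleftrightarrow> A \<subseteq> B \<or> B \<subseteq> A"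

lemma comparable_image: "comparable A B \<Longrightarrow> comparable (f ` A) (f ` B)"
  by (auto simp: comparable_def)

lemma column_subset: "column n w j \<subseteq> {1..n}"
  by (auto simp: column_def)

lemma finite_column: "finite (column n w j)"
  using finite_subset[OF column_subset] by blast

lemma card_column_le: "card (column n w j) \<le> n"
  using card_mono[OF _ column_subset] by simp

lemma inv_swap_at:
  assumes "w permutes {1..n}"
  shows "inv (swap_at w i) j = transpose i (Suc i) (inv w j)"
  using assms by (simp add: o_inv_distrib permutes_bij)

text \<open>
  The hypothesis \<open>j \<noteq> w i\<close> excludes the only column that acquires a new box, namely in row \<open>i\<close>.
\<close>

lemma column_swap_at:
  assumes w: "w permutes {1..n}" and i: "ascent n w i" and j: "j \<noteq> w i"
  shows "column n (swap_at w i) j = transpose i (Suc i) ` column n w j"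
proof -
  let ?t = "transpose i (Suc i)"
  have i': "1 \<le> i" "i < n" "w i < w (Suc i)" using i by (auto simp: ascent_def)
  define p where "p = inv w j"
  have wp: "w p = j" using permutes_inverses(1)[OF w] by (simp add: p_def)
  have p: "p \<noteq> i" using wp j by auto
  have "r \<in> column n (swap_at w i) j \<longleftrightarrow> ?t r \<in> column n w j" for r
  proof -
    have "?t r \<in> {1..n} \<longleftrightarrow> r \<in> {1..n}" using i' by (auto simp: transpose_def)
    moreover have "(r < ?t p \<and> j < w (?t r)) \<longleftrightarrow> (?t r < p \<and> j < w (?t r))"
      using p i' wp by (auto simp: transpose_def)
    ultimately show ?thesis
      by (auto simp: column_def inv_swap_at[OF w] simp flip: p_def)
  qed
  moreover have "r \<in> ?t ` A \<longleftrightarrow> ?t r \<in> A" for r A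
    by (auto intro: rev_image_eqI[of "?t r"])
  ultimately show ?thesis by (intro set_eqI) simp
qed

lemma ascent_column:
  assumes w: "w permutes {1..n}" and i: "ascent n w i" and "i \<in> column n w j"
  shows "Suc i \<in> column n w j"
proof -
  have "w (inv w j) = j" using permutes_inverses(1)[OF w] .
  moreover have "i < inv w j" "j < w i" "w i < w (Suc i)" "i < n"
    using assms by (auto simp: column_def ascent_def)
  ultimately show ?thesis by (auto simp: column_def) (metis Suc_lessI less_trans nat_neq_iff)
qed

text \<open>
  Before the first ascent \<open>w\<close> decreases, so its value there is a left-to-right minimum. This makes the column of
  that value an initial interval, both before and after the exchange.
\<close>

lemma first_ascent:
  assumes "w permutes {1..n}" "ascent n w k"
  obtains i where "ascent n w i" "\<And>r. 1 \<le> r \<Longrightarrow> r < i \<Longrightarrow> w i < w r"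
proof -
  define i where "i = (LEAST i. ascent n w i)"
  have i: "ascent n w i" and least: "\<And>r. r < i \<Longrightarrow> \<not> ascent n w r"
    unfolding i_def using assms(2) by (auto intro: LeastI dest: not_less_Least)
  have inj: "inj w" using assms(1) permutes_inj by blast
  have le: "w i \<le> w r" if "r \<le> i" "1 \<le> r" for r
    using that
  proof (induction r rule: inc_induct)
    case (step r)
    then have "w (Suc r) \<le> w r" using least[of r] i by (simp add: ascent_def)
    then show ?case using step by simp
  qed simp
  have "w i < w r" if "1 \<le> r" "r < i" for r
    using le[of r] that injD[OF inj, of i r] by (metis le_neq_implies_less less_imp_le nat_neq_iff)
  then show ?thesis using that i by blast
qed

lemma column_first_ascent:
  assumes w: "w permutes {1..n}" and i: "ascent n w i" and first: "\<And>r. 1 \<le> r \<Longrightarrow> r < i \<Longrightarrow> w i < w r"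
  shows "column n w (w i) = {1..i - 1}" "column n (swap_at w i) (w i) = {1..i}"
proof -
  have i': "1 \<le> i" "i < n" "w i < w (Suc i)" using i by (auto simp: ascent_def)
  have inv: "inv w (w i) = i" using permutes_inverses(2)[OF w] .
  show "column n w (w i) = {1..i - 1}"
    using first i' by (auto simp: column_def inv)
  show "column n (swap_at w i) (w i) = {1..i}"
    using first i' by (auto simp: column_def inv inv_swap_at[OF w] transpose_def)
qed

lemma sum_card_column:
  assumes w: "w permutes {1..n}"
  shows "(\<Sum>j=1..n. card (column n w j)) = inversions n w"
proof -
  have inv: "inv w (w p) = p" for p using permutes_inverses(2)[OF w] .
  have "(\<Sum>j=1..n. card (column n w j)) = (\<Sum>p=1..n. card (column n w (w p)))"
    using sum.permute[OF w, of "\<lambda>j. card (column n w j)"] by (simp add: comp_def)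
  also have "\<dots> = card (SIGMA p:{1..n}. column n w (w p))"
    by (rule card_SigmaI[symmetric]) (auto simp: finite_column)
  also have "(SIGMA p:{1..n}. column n w (w p)) = prod.swap ` inversion_pairs n w"
    by (auto simp: column_def inv inversion_pairs_def image_iff)
  also have "card \<dots> = inversions n w"
    by (simp add: card_image inversions_eq_card)
  finally show ?thesis .
qed

text \<open>
  Rows \<open>r\<close>, \<open>s\<close> witnessing that columns \<open>j < k\<close> are incomparable, together with the rows of the dots of the two
  columns, form the pattern 2143: the rows in order are \<open>r\<close>, \<open>inv w j\<close>, \<open>s\<close>, \<open>inv w k\<close>.
\<close>

lemma vexillary_columns:
  assumes w: "w permutes {1..n}" and "vexillary n w"
  shows "comparable (column n w j) (column n w k)"
proof -
  have *: "comparable (column n w j) (column n w k)" if "j < k" for j k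
  proof (rule ccontr)
    assume "\<not> comparable (column n w j) (column n w k)"
    then obtain r s where r: "r \<in> column n w j" "r \<notin> column n w k"
      and s: "s \<in> column n w k" "s \<notin> column n w j"
      by (auto simp: comparable_def)
    define p q where "p = inv w j" and "q = inv w k"
    have wp: "w p = j" "w q = k" using permutes_inverses(1)[OF w] by (auto simp: p_def q_def)
    have r': "1 \<le> r" "r \<le> n" "r < p" "j < w r" "\<not> (r < q \<and> k < w r)"
      using r by (auto simp: column_def p_def q_def)
    have s': "1 \<le> s" "s \<le> n" "s < q" "k < w s" "\<not> (s < p \<and> j < w s)"
      using s by (auto simp: column_def p_def q_def)
    have "p < s" using s' wp that by (metis less_trans nat_neq_iff)
    then have "r < q" using r' s' by simp
    then have "w r \<noteq> k" using injD[OF permutes_inj[OF w], of r q] wp by auto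
    then have "w r < k" using r' \<open>r < q\<close> by simp
    moreover have "q \<le> n"
    proof (rule ccontr)
      assume "\<not> q \<le> n"
      then have "w q = q" using w by (simp add: permutes_not_in)
      moreover have "w s \<in> {1..n}" using s' permutes_in_image[OF w, of s] by simp
      ultimately show False using wp s' \<open>\<not> q \<le> n\<close> by simp
    qed
    ultimately show False
      using assms(2) r' s' wp \<open>p < s\<close> unfolding vexillary_def by blast
  qed
  show ?thesis
    using *[of j k] *[of k j] by (cases j k rule: linorder_cases) (auto simp: comparable_def)
qed

section \<open>Vexillary permutations and words of operators\<close>

abbreviation factor_of :: "nat \<Rightarrow> (nat \<Rightarrow> nat) \<Rightarrow> nat \<Rightarrow> int mpoly" where
  "factor_of n w j \<equiv> column_factor n (card (column n w j))"

text \<open>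
  The columns in \<open>J\<close> stand outside the word, the others inside. The last condition restricts the word: \<open>n - a\<close> is the only
  index whose operator does not commute with \<open>column_factor n a\<close>, and it may occur only if \<open>{1..a}\<close> would break the
  chain formed by the columns inside.
\<close>

definition sorts_columns :: "nat \<Rightarrow> (nat \<Rightarrow> nat) \<Rightarrow> nat set \<Rightarrow> nat list \<Rightarrow> bool" where
  "sorts_columns n w J us \<longleftrightarrow> set us \<subseteq> {1..<n} \<and>
    co_schubert n w = (\<Prod>j\<in>J. factor_of n w j) * foldr pi_bar us (\<Prod>j\<in>{1..n} - J. factor_of n w j) \<and>
    (\<forall>a. (\<forall>j\<in>{1..n} - J. comparable {1..a} (column n w j)) \<longrightarrow> n - a \<notin> set us)"

text \<open>
  A column \<open>{1..a}\<close> that is comparable with the columns inside can be moved into the word, since by the last condition of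
  \<open>sorts_columns\<close> no operator of the word obstructs its factor.
\<close>

lemma sorts_columns_release:
  assumes us: "sorts_columns n w (insert c J) us" and c: "c \<in> {1..n} - J"
    and col: "column n w c = {1..a}"
    and chain: "\<And>j. j \<in> {1..n} - J \<Longrightarrow> comparable (column n w c) (column n w j)"
    and J: "J \<subseteq> {1..n}"
  shows "sorts_columns n w J us"
proof -
  let ?g = "factor_of n w"
  have fin: "finite J" using J finite_subset by blast
  have set: "set us \<subseteq> {1..<n}" using us by (simp add: sorts_columns_def)
  have na: "n - a \<notin> set us"
  proof -
    have "\<forall>j\<in>{1..n} - insert c J. comparable {1..a} (column n w j)"
      using chain unfolding col by auto
    then show ?thesis using us unfolding sorts_columns_def by blast
  qed
  have "swap_vars k (?g c) = ?g c" if "k \<in> set us" for k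
    by (rule swap_vars_column_factor) (use that set na in \<open>auto simp: col\<close>)
  then have "foldr pi_bar us (?g c * p) = ?g c * foldr pi_bar us p" for p
    by (rule foldr_pi_bar_symmetric_mult)
  moreover have R: "{1..n} - J = insert c ({1..n} - insert c J)" using c by auto
  have "(\<Prod>j\<in>{1..n} - J. ?g j) = ?g c * (\<Prod>j\<in>{1..n} - insert c J. ?g j)"
    by (subst R, rule prod.insert) auto
  moreover have "(\<Prod>j\<in>insert c J. ?g j) = ?g c * (\<Prod>j\<in>J. ?g j)" using c fin by simp
  moreover have "\<forall>j\<in>{1..n} - insert c J. P j" if "\<forall>j\<in>{1..n} - J. P j" for P
    using that by blast
  ultimately show ?thesis using us unfolding sorts_columns_def by (simp only: mult.assoc mult.left_commute) blast
qed

text \<open>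
  Let \<open>i\<close> be the first ascent. In \<open>swap_at w i\<close> the column of the value \<open>w i\<close> is \<open>{1..i}\<close>, and
  \<open>co_diff (n - i)\<close> shortens it to \<open>{1..i - 1}\<close>, its form in \<open>w\<close>, while \<open>pi_bar (n - i)\<close> is prepended to
  the word. If \<open>{1..i}\<close> is comparable with all columns inside, however, the longer word would violate the last condition of
  \<open>sorts_columns\<close>. In that case no column inside separates the rows \<open>i\<close> and \<open>i + 1\<close>, so that \<open>{1..i - 1}\<close> and
  \<open>{1..i + 1}\<close> are comparable with all columns inside as well. The word then contains no index next to \<open>n - i\<close>, and
  the new operator can be moved through it to the symmetric product inside, where it acts trivially.
\<close>

lemma sorts_columns_step:
  assumes w: "w permutes {1..n}" and i: "ascent n w i"
    and first: "\<And>r. 1 \<le> r \<Longrightarrow> r < i \<Longrightarrow> w i < w r"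
    and J: "J \<subseteq> {1..n}" "w i \<in> J"
    and std: "\<And>j. j \<in> J \<Longrightarrow> column n w j = {1..card (column n w j)}"
    and us: "sorts_columns n (swap_at w i) J us"
  shows "\<exists>us. sorts_columns n w J us"
proof -
  let ?v = "swap_at w i" and ?t = "transpose i (Suc i)"
  let ?g = "factor_of n w" and ?R = "{1..n} - J"
  have i': "1 \<le> i" "i < n" using i by (auto simp: ascent_def)
  have fin: "finite J" using J finite_subset by blast
  note colv = column_swap_at[OF w i]
  have cardv: "card (column n ?v j) = card (column n w j)" if "j \<noteq> w i" for j
    using colv[OF that] by (simp add: card_image)
  define M where "M = (\<Prod>j\<in>J - {w i}. ?g j)"
  define N where "N = (\<Prod>j\<in>?R. ?g j)"
  have set: "set us \<subseteq> {1..<n}" using us by (simp add: sorts_columns_def)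
  have "(\<Prod>j\<in>J. factor_of n ?v j) = column_factor n i * M"
    using J fin by (simp add: prod.remove[of J "w i"] M_def cardv column_first_ascent(2)[OF w i first])
  moreover have "(\<Prod>j\<in>?R. factor_of n ?v j) = N"
    unfolding N_def
  proof (rule prod.cong[OF refl])
    fix j assume "j \<in> ?R"
    then have "j \<noteq> w i" using J by auto
    from cardv[OF this] show "factor_of n ?v j = ?g j" by (simp only:)
  qed
  ultimately have v: "co_schubert n ?v = column_factor n i * (M * foldr pi_bar us N)"
    using us by (simp add: sorts_columns_def mult.assoc)
  have symM: "swap_vars (n - i) M = M"
    unfolding M_def
  proof (rule swap_vars_prod_invariant)
    fix j assume j: "j \<in> J - {w i}"
    have "card (column n w j) \<noteq> i"
      using ascent_column[OF w i, of j] std[of j] j i' by (metis DiffD1 Suc_n_not_le_n atLeastAtMost_iff order_refl)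
    then show "swap_vars (n - i) (?g j) = ?g j"
      using i' card_column_le[of n w j] by (intro swap_vars_column_factor) auto
  qed
  have "co_schubert n w = column_factor n (i - 1) * M * pi_bar (n - i) (foldr pi_bar us N)"
    unfolding co_schubert_ascent[OF w i] v co_diff_column_factor[OF i'] pi_bar_symmetric_mult[OF symM]
    by (simp add: mult.assoc)
  also have "column_factor n (i - 1) * M = (\<Prod>j\<in>J. ?g j)"
    using J fin by (simp add: prod.remove[of J "w i"] M_def column_first_ascent(1)[OF w i first])
  finally have cw: "co_schubert n w = (\<Prod>j\<in>J. ?g j) * pi_bar (n - i) (foldr pi_bar us N)" .
  have avoid: "n - a \<notin> set us" if "\<forall>j\<in>?R. comparable {1..a} (column n ?v j)" for a
    using us that by (auto simp: sorts_columns_def)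
  show ?thesis
  proof (cases "\<forall>j\<in>?R. comparable {1..i} (column n w j)")
    case True
    \<comment> \<open>Since \<open>i\<close> is an ascent, a column comparable with \<open>{1..i}\<close> contains both of the rows \<open>i\<close>, \<open>i + 1\<close> or neither.\<close>
    have both: "i \<in> column n w j \<longleftrightarrow> Suc i \<in> column n w j" if "j \<in> ?R" for j
    proof
      assume "Suc i \<in> column n w j"
      then have "\<not> column n w j \<subseteq> {1..i}" by auto
      then have "{1..i} \<subseteq> column n w j" using True that by (auto simp: comparable_def)
      then show "i \<in> column n w j" using i' by auto
    qed (rule ascent_column[OF w i])
    have same: "column n ?v j = column n w j" if "j \<in> ?R" for j
      using that J colv[of j] transpose_image_eq[OF both[OF that]] by auto
    have "comparable {1..a} (column n w j)" if "j \<in> ?R" "a \<in> {i - 1, i, Suc i}" for a j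
    proof (cases "{1..i} \<subseteq> column n w j")
      case sub: True
      then have "{1..Suc i} \<subseteq> column n w j" using both[OF that(1)] i' by (auto simp: le_Suc_eq)
      moreover have "{1..a} \<subseteq> {1..Suc i}" using that(2) by auto
      ultimately show ?thesis unfolding comparable_def by blast
    next
      case nsub: False
      then have "column n w j \<subseteq> {1..i}" using True that(1) by (auto simp: comparable_def)
      moreover have "i \<notin> column n w j" using calculation both[OF that(1)] by auto
      ultimately have "column n w j \<subseteq> {1..i - 1}" by (force simp: le_less)
      moreover have "{1..i - 1} \<subseteq> {1..a}" using that(2) by auto
      ultimately show ?thesis unfolding comparable_def by blast
    qed
    then have av: "n - a \<notin> set us" if "a \<in> {i - 1, i, Suc i}" for a
      using avoid[of a] same that by simp
    have "Suc k < n - i \<or> Suc (n - i) < k" if k: "k \<in> set us" for k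
    proof -
      have "k \<noteq> n - i" "k \<noteq> n - (i - 1)" "k \<noteq> n - Suc i"
        using av[of i] av[of "i - 1"] av[of "Suc i"] k by auto
      then show ?thesis using i' by arith
    qed
    then have "pi_bar (n - i) (foldr pi_bar us N) = foldr pi_bar us (pi_bar (n - i) N)"
      by (rule foldr_pi_bar_commute)
    also have "swap_vars (n - i) N = N"
      unfolding N_def
    proof (rule swap_vars_prod_invariant)
      fix j assume j: "j \<in> ?R"
      have "card (column n w j) \<noteq> i"
      proof
        assume c: "card (column n w j) = i"
        have "comparable {1..i} (column n w j)" using True j by blast
        then have "column n w j = {1..i}"
          using card_subset_eq[of "column n w j" "{1..i}"] card_subset_eq[of "{1..i}" "column n w j"] c
          unfolding comparable_def by (metis card_atLeastAtMost diff_Suc_1 finite_atLeastAtMost finite_column)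
        then show False using both[OF j] i' by simp
      qed
      then show "swap_vars (n - i) (?g j) = ?g j"
        using i' card_column_le[of n w j] by (intro swap_vars_column_factor) auto
    qed
    then have "pi_bar (n - i) N = N" by (rule pi_bar_symmetric)
    finally have "sorts_columns n w J us"
      using cw set avoid same by (simp add: sorts_columns_def N_def)
    then show ?thesis by blast
  next
    case False
    have "n - a \<notin> set ((n - i) # us)" if a: "\<forall>j\<in>?R. comparable {1..a} (column n w j)" for a
    proof -
      have "a \<noteq> i" using False a by blast
      then have "?t ` {1..a} = {1..a}" using i' by (intro transpose_image_eq) auto
      then have "\<forall>j\<in>?R. comparable {1..a} (column n ?v j)"
        using a J colv comparable_image[of "{1..a}" _ ?t] by (metis DiffD2)
      then show ?thesis using avoid \<open>a \<noteq> i\<close> i' by auto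
    qed
    then have "sorts_columns n w J ((n - i) # us)"
      using cw set i' by (simp add: sorts_columns_def N_def)
    then show ?thesis by blast
  qed
qed

text \<open>
  Induction from the longest permutation downwards. The column of the first ascent is an initial interval, so it may be
  kept outside during the step and released into the word afterwards. The set \<open>J\<close> is general because the column
  released for \<open>w\<close> has to remain outside in the induction hypothesis: after the exchange the chain condition may fail for it.
\<close>

lemma sorts_columns_exists:
  assumes "w permutes {1..n}" "J \<subseteq> {1..n}"
    "\<And>j. j \<in> J \<Longrightarrow> column n w j = {1..card (column n w j)}"
    "\<And>j k. j \<in> {1..n} - J \<Longrightarrow> k \<in> {1..n} - J \<Longrightarrow> comparable (column n w j) (column n w k)"
  shows "\<exists>us. sorts_columns n w J us"
  using assms
proof (induction "n * n - inversions n w" arbitrary: w J rule: less_induct)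
  case less
  note w = less.prems(1) and J = less.prems(2) and std = less.prems(3) and chain = less.prems(4)
  have fin: "finite J" using J finite_subset by blast
  show ?case
  proof (cases "\<exists>i. ascent n w i")
    case False
    then have w0: "w = longest_perm n" using ascent_or_longest_perm w by blast
    have "factor_of n w j = column_factor n (n - j)" if "j \<in> {1..n}" for j
    proof -
      have "inv w j = n + 1 - j"
      proof -
        have "w (n + 1 - j) = j" using that by (auto simp: w0 longest_perm_def)
        then show ?thesis using permutes_inverses(2)[OF w, of "n + 1 - j"] by simp
      qed
      then have "column n w j = {1..n - j}" using that by (auto simp: column_def w0 longest_perm_def)
      then show ?thesis by simp
    qed
    then have "co_schubert n w = (\<Prod>j\<in>{1..n}. factor_of n w j)"
      unfolding w0 co_schubert_longest by simp
    also have "\<dots> = (\<Prod>j\<in>J. factor_of n w j) * (\<Prod>j\<in>{1..n} - J. factor_of n w j)"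
      using J by (simp add: prod.subset_diff mult.commute)
    finally have "sorts_columns n w J []" by (simp add: sorts_columns_def)
    then show ?thesis by blast
  next
    case True
    then obtain i where i: "ascent n w i" and first: "\<And>r. 1 \<le> r \<Longrightarrow> r < i \<Longrightarrow> w i < w r"
      using first_ascent[OF w] by metis
    have i': "1 \<le> i" "i < n" using i by (auto simp: ascent_def)
    define J' where "J' = insert (w i) J"
    have wi: "w i \<in> {1..n}" using permutes_in_image[OF w, of i] i' by simp
    have J': "J' \<subseteq> {1..n}" "w i \<in> J'" using J wi by (auto simp: J'_def)
    note c = column_first_ascent[OF w i first]
    have std': "column n w j = {1..card (column n w j)}" if "j \<in> J'" for j
      using that std c(1) by (auto simp: J'_def)
    have "\<exists>us. sorts_columns n (swap_at w i) J' us"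
    proof (rule less.hyps[OF swap_at_decreases[OF i] swap_at_permutes[OF w i'] J'(1)])
      fix j assume j: "j \<in> J'"
      show "column n (swap_at w i) j = {1..card (column n (swap_at w i) j)}"
      proof (cases "j = w i")
        case False
        have "i \<in> column n w j \<longleftrightarrow> Suc i \<in> column n w j"
          using ascent_column[OF w i, of j] std'[OF j] i' by (metis Suc_leD atLeastAtMost_iff)
        then show ?thesis
          using column_swap_at[OF w i False] transpose_image_eq std'[OF j] by simp
      qed (simp add: c(2))
    next
      fix j k assume "j \<in> {1..n} - J'" "k \<in> {1..n} - J'"
      then show "comparable (column n (swap_at w i) j) (column n (swap_at w i) k)"
        using column_swap_at[OF w i] chain by (auto simp: J'_def intro: comparable_image)
    qed
    then obtain us where us: "sorts_columns n w J' us"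
      using sorts_columns_step[OF w i first J' std'] by blast
    show ?thesis
    proof (cases "w i \<in> J")
      case True
      then show ?thesis using us by (auto simp: J'_def insert_absorb)
    next
      case False
      then show ?thesis
        using sorts_columns_release[OF us[unfolded J'_def] _ c(1) _ J] chain wi by blast
    qed
  qed
qed

lemma co_schubert_vexillary:
  assumes "w permutes {1..n}" "vexillary n w"
  obtains us where "set us \<subseteq> {1..<n}" "co_schubert n w = foldr pi_bar us (\<Prod>j=1..n. factor_of n w j)"
  using sorts_columns_exists[of w n "{}"] vexillary_columns[OF assms] assms(1) by (auto simp: sorts_columns_def)

section \<open>Signed sums of words applied to dominant monomials\<close>

text \<open>
  The parameters \<open>a\<close> and \<open>J\<close> describe the state after multiplying \<open>J\<close> column factors, all of which contain the variables
  \<open>x\<^sub>1, \<dots>, x\<^sub>a\<close>: the first \<open>a\<close> parts are equal to \<open>J\<close>, no part exceeds \<open>J\<close>, and the operators leave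
  the first \<open>a\<close> positions alone. Only the parity of \<open>d\<close> matters.
\<close>

inductive_set demazure_cone :: "nat \<Rightarrow> nat \<Rightarrow> nat \<Rightarrow> nat \<Rightarrow> int mpoly set"
  for n a J d where
  zero: "0 \<in> demazure_cone n a J d"
| add: "f + (-1) ^ (total_degree \<mu> + d) * foldr pi_bar us (Poly_Mapping.single \<mu> 1) \<in> demazure_cone n a J d"
  if "f \<in> demazure_cone n a J d" "dominant n \<mu>"
    "\<And>i. 1 \<le> i \<Longrightarrow> i \<le> a \<Longrightarrow> Poly_Mapping.lookup \<mu> i = J"
    "\<And>i. Poly_Mapping.lookup \<mu> i \<le> J" "set us \<subseteq> {a<..<n}"

lemma demazure_cone_add:
  assumes "f \<in> demazure_cone n a J d" "g \<in> demazure_cone n a J d"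
  shows "f + g \<in> demazure_cone n a J d"
  using assms(2)
proof induction
  case zero
  then show ?case using assms(1) by simp
next
  case (add g \<mu> us)
  from demazure_cone.add[OF add.IH add.hyps(2-5)] show ?case by (simp only: add.assoc)
qed

lemma demazure_cone_sign:
  assumes "f \<in> demazure_cone n a J d" "even (d + k) = even d'"
  shows "(-1) ^ k * f \<in> demazure_cone n a J d'"
  using assms(1)
proof induction
  case (add g \<mu> us)
  let ?h = "foldr pi_bar us (Poly_Mapping.single \<mu> 1) :: int mpoly"
  have "(-1) ^ k * (-1) ^ (total_degree \<mu> + d) = ((-1) ^ (total_degree \<mu> + d') :: int mpoly)"
  proof -
    have "even (k + (total_degree \<mu> + d)) = even (total_degree \<mu> + d')" using assms(2) by auto
    then show ?thesis by (subst power_add[symmetric]) (simp only: minus_one_power_iff)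
  qed
  then have "(-1) ^ k * (g + (-1) ^ (total_degree \<mu> + d) * ?h) =
      (-1) ^ k * g + (-1) ^ (total_degree \<mu> + d') * ?h"
    by (simp only: distrib_left mult.assoc[symmetric])
  then show ?case using demazure_cone.add[OF add.IH add.hyps(2-5)] by simp
qed (simp add: demazure_cone.zero)

lemma demazure_cone_minus:
  "f \<in> demazure_cone n a J (Suc d) \<Longrightarrow> - f \<in> demazure_cone n a J d"
  using demazure_cone_sign[of f n a J "Suc d" 1 d] by simp

lemma demazure_cone_mono:
  assumes "f \<in> demazure_cone n b J d" "a \<le> b"
  shows "f \<in> demazure_cone n a J d"
  using assms(1)
proof induction
  case (add g \<mu> us)
  show ?case
    by (rule demazure_cone.add) (use add assms(2) in auto)
qed (simp add: demazure_cone.zero)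

lemma swap_vars_sign: "swap_vars k ((-1) ^ e) = (-1) ^ e"
  by (simp add: ring_hom_power[OF ring_hom_swap_vars])

lemma demazure_cone_pi_bar:
  assumes "f \<in> demazure_cone n a J d" "a < k" "k < n"
  shows "pi_bar k f \<in> demazure_cone n a J d"
  using assms(1)
proof induction
  case (add g \<mu> us)
  have "set (k # us) \<subseteq> {a<..<n}" using add.hyps assms by simp
  from demazure_cone.add[OF add.IH add.hyps(2-4) this]
  show ?case by (simp add: pi_bar_add pi_bar_symmetric_mult swap_vars_sign)
qed (simp add: demazure_cone.zero)

lemma demazure_cone_word:
  "f \<in> demazure_cone n a J d \<Longrightarrow> set us \<subseteq> {a<..<n} \<Longrightarrow> foldr pi_bar us f \<in> demazure_cone n a J d"
  by (induction us) (auto intro: demazure_cone_pi_bar)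

lemma demazure_cone_monomial:
  assumes "dominant n \<mu>" "\<And>i. 1 \<le> i \<Longrightarrow> i \<le> a \<Longrightarrow> Poly_Mapping.lookup \<mu> i = J"
    "\<And>i. Poly_Mapping.lookup \<mu> i \<le> J"
  shows "Poly_Mapping.single \<mu> 1 \<in> demazure_cone n a J (total_degree \<mu>)"
proof -
  have "0 + (-1) ^ (total_degree \<mu> + total_degree \<mu>) * foldr pi_bar [] (Poly_Mapping.single \<mu> 1)
      \<in> demazure_cone n a J (total_degree \<mu>)"
    by (rule demazure_cone.add[OF demazure_cone.zero assms]) auto
  then show ?thesis by (simp add: minus_one_power_iff)
qed

lemma pi_bar_1_minus_X: "pi_bar i (1 - X i) = (1 - X i) * (1 - X (Suc i))"
  unfolding pi_bar_alt by (rule div_diff_unique) (simp add: algebra_simps)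

lemma dominant_antimono:
  assumes "dominant n \<mu>" "1 \<le> i" "i \<le> j" "j \<le> n"
  shows "Poly_Mapping.lookup \<mu> j \<le> Poly_Mapping.lookup \<mu> i"
  using assms(3,4)
proof (induction j rule: dec_induct)
  case (step j)
  then have "Poly_Mapping.lookup \<mu> (Suc j) \<le> Poly_Mapping.lookup \<mu> j"
    using assms(1,2) by (auto simp: dominant_def)
  then show ?case using step by simp
qed simp

text \<open>
  Induction on the number of variables in the product. The first block of equal parts after position \<open>c\<close> ends at some
  \<open>b\<close>. The product over the variables after \<open>b\<close> is covered by the induction hypothesis. The product over the block is one minus a
  word of operators applied to its first variable. That variable can be absorbed into the monomial, because there is a gap
  between the parts \<open>c\<close> and \<open>c + 1\<close>, and the remaining factors commute with these operators.
\<close>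

lemma monomial_times_tail:
  assumes "dominant n \<mu>" "a \<le> c" "c \<le> n"
    "\<And>i. 1 \<le> i \<Longrightarrow> i \<le> a \<Longrightarrow> Poly_Mapping.lookup \<mu> i = J"
    "\<And>i. Poly_Mapping.lookup \<mu> i \<le> J"
    "\<And>i k. 1 \<le> i \<Longrightarrow> i \<le> c \<Longrightarrow> c < k \<Longrightarrow> k \<le> n \<Longrightarrow> Poly_Mapping.lookup \<mu> k < Poly_Mapping.lookup \<mu> i"
    "\<And>k. c < k \<Longrightarrow> k \<le> n \<Longrightarrow> Poly_Mapping.lookup \<mu> k < J"
  shows "Poly_Mapping.single \<mu> 1 * (\<Prod>k=c + 1..n. 1 - X k) \<in> demazure_cone n a J (total_degree \<mu>)"
  using assms
proof (induction "n - c" arbitrary: c \<mu> rule: less_induct)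
  case less
  note dom = less.prems(1) and ac = less.prems(2) and cn = less.prems(3)
    and eqJ = less.prems(4) and leJ = less.prems(5) and gap = less.prems(6) and ltJ = less.prems(7)
  let ?l = "Poly_Mapping.lookup \<mu>"
  show ?case
  proof (cases "c = n")
    case True
    then show ?thesis using demazure_cone_monomial[OF dom eqJ leJ] by simp
  next
    case False
    define b where "b = Max {k \<in> {c + 1..n}. ?l k = ?l (c + 1)}"
    have "c + 1 \<in> {k \<in> {c + 1..n}. ?l k = ?l (c + 1)}" using False cn by simp
    then have "b \<in> {k \<in> {c + 1..n}. ?l k = ?l (c + 1)}"
      unfolding b_def by (intro Max_in) (simp, blast)
    then have b: "c < b" "b \<le> n" "?l b = ?l (c + 1)" by auto
    have drop: "?l (Suc b) < ?l b" if "b < n"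
    proof -
      have "?l (Suc b) \<noteq> ?l (c + 1)"
      proof
        assume "?l (Suc b) = ?l (c + 1)"
        then have "Suc b \<in> {k \<in> {c + 1..n}. ?l k = ?l (c + 1)}" using b that by auto
        then have "Suc b \<le> b" unfolding b_def by (intro Max_ge) auto
        then show False by simp
      qed
      moreover have "?l (Suc b) \<le> ?l b" using dominant_antimono[OF dom, of b "Suc b"] b that by simp
      ultimately show ?thesis using b(3) by simp
    qed
    have gapb: "?l k < ?l i" if "1 \<le> i" "i \<le> b" "b < k" "k \<le> n" for i k
    proof -
      have "?l b \<le> ?l i" by (rule dominant_antimono[OF dom]) (use that b in auto)
      moreover have "?l k \<le> ?l (Suc b)" by (rule dominant_antimono[OF dom]) (use that in auto)
      ultimately show ?thesis using drop that by simp
    qed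
    have const: "?l k = ?l (c + 1)" if "c < k" "k \<le> b" for k
      using dominant_antimono[OF dom, of "c + 1" k] dominant_antimono[OF dom, of k b] that b by simp
    let ?T = "\<Prod>k=b + 1..n. 1 - X k :: int mpoly"
    define Y where "Y = Poly_Mapping.single \<mu> 1 * ?T"
    have Y: "Y \<in> demazure_cone n a J (total_degree \<mu>)"
      unfolding Y_def
      by (rule less.hyps) (use b cn ac dom eqJ leJ gapb ltJ in auto)
    define P where "P m = (\<Prod>k=c + 1..m. 1 - X k :: int mpoly)" for m
    \<comment> \<open>\<open>Y * (1 - P m)\<close> arises from \<open>Y * X (c + 1)\<close> by applying \<open>pi_bar (c + 1)\<close>, ..., \<open>pi_bar (m - 1)\<close>.\<close>
    have Z: "Y * (1 - P m) \<in> demazure_cone n a J (Suc (total_degree \<mu>))" if "c + 1 \<le> m" "m \<le> b" for m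
      using that
    proof (induction m rule: dec_induct)
      case base
      let ?\<mu> = "\<mu> + Poly_Mapping.single (Suc c) (Suc 0)"
      have look: "Poly_Mapping.lookup ?\<mu> i = ?l i + (if i = Suc c then 1 else 0)" for i
        by (simp add: lookup_add lookup_single when_def)
      have "Poly_Mapping.single ?\<mu> 1 * ?T \<in> demazure_cone n a J (total_degree ?\<mu>)"
      proof (rule less.hyps)
        show "dominant n ?\<mu>"
          unfolding dominant_def compositions_iff look
          using dom gap[of c "c + 1"] False cn by (auto simp: dominant_def compositions_iff)
        show "Poly_Mapping.lookup ?\<mu> i \<le> J" for i
          using leJ[of i] ltJ[of "c + 1"] False cn by (auto simp: look)
        show "Poly_Mapping.lookup ?\<mu> k < Poly_Mapping.lookup ?\<mu> i" if "1 \<le> i" "i \<le> b" "b < k" "k \<le> n" for i k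
          using gapb[OF that] that b by (simp add: look)
        show "Poly_Mapping.lookup ?\<mu> k < J" if "b < k" "k \<le> n" for k
          using ltJ[of k] that b by (simp add: look)
      qed (use b cn ac eqJ in \<open>auto simp: look\<close>)
      moreover have "Poly_Mapping.single ?\<mu> (1::int) = Poly_Mapping.single \<mu> 1 * X (c + 1)"
        by (simp add: X_def mult_single)
      then have "Y * (1 - P (c + 1)) = Poly_Mapping.single ?\<mu> 1 * ?T"
        by (simp add: Y_def P_def mult_ac)
      ultimately show ?case by (simp add: total_degree_add total_degree_single)
    next
      case (step m)
      have m: "m < b" "c < m" using step by auto
      have sY: "swap_vars m Y = Y"
      proof -
        have "swap_vars m ?T = ?T" by (rule swap_vars_prod_1_minus_X) (use m in auto)
        moreover have "swap_vars m (Poly_Mapping.single \<mu> (1::int)) = Poly_Mapping.single \<mu> 1"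
          by (rule monomial_symmetric) (use const[of m] const[of "Suc m"] m in simp)
        ultimately show ?thesis by (simp only: Y_def swap_vars_simps)
      qed
      have sP: "swap_vars m (P (m - 1)) = P (m - 1)"
        unfolding P_def by (rule swap_vars_prod_1_minus_X) (use m in auto)
      have Pm: "P m = P (m - 1) * (1 - X m)"
      proof -
        have "{c + 1..m} = insert m {c + 1..m - 1}" using m by auto
        moreover have "(\<Prod>k\<in>insert m {c + 1..m - 1}. 1 - X k) = (1 - X m) * P (m - 1)"
          unfolding P_def by (rule prod.insert) (use m in auto)
        ultimately show ?thesis by (simp add: P_def mult.commute)
      qed
      have "P (Suc m) = P m * (1 - X (Suc m))"
        using m by (simp add: P_def)
      then have PSm: "P (Suc m) = P (m - 1) * ((1 - X m) * (1 - X (Suc m)))"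
        by (simp only: Pm mult.assoc)
      have "pi_bar m (1 - P m) = 1 - P (Suc m)"
      proof -
        have "pi_bar m (1 + - (P (m - 1) * (1 - X m))) = 1 + - (P (m - 1) * ((1 - X m) * (1 - X (Suc m))))"
          by (simp only: pi_bar_add pi_bar_minus pi_bar_1 pi_bar_symmetric_mult[OF sP] pi_bar_1_minus_X)
        then show ?thesis by (simp add: Pm PSm)
      qed
      then have "pi_bar m (Y * (1 - P m)) = Y * (1 - P (Suc m))"
        by (simp only: pi_bar_symmetric_mult[OF sY])
      moreover have "pi_bar m (Y * (1 - P m)) \<in> demazure_cone n a J (Suc (total_degree \<mu>))"
        by (rule demazure_cone_pi_bar) (use step m b ac in auto)
      ultimately show ?case by simp
    qed
    have "(\<Prod>k=c + 1..n. 1 - X k :: int mpoly) = P b * ?T"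
    proof -
      have "{c + 1..n} = {c + 1..b} \<union> {b + 1..n}" using b by auto
      then show ?thesis unfolding P_def by (simp only:) (rule prod.union_disjoint, auto)
    qed
    then have "Poly_Mapping.single \<mu> 1 * (\<Prod>k=c + 1..n. 1 - X k) = Y + - (Y * (1 - P b))"
      by (simp add: Y_def algebra_simps)
    also have "\<dots> \<in> demazure_cone n a J (total_degree \<mu>)"
      using Y Z[of b] b by (intro demazure_cone_add demazure_cone_minus) auto
    finally show ?thesis .
  qed
qed

text \<open>
  Adding one to the first \<open>a\<close> parts creates the gap required by \<open>monomial_times_tail\<close>.
\<close>

lemma column_factor_times_monomial:
  assumes dom: "dominant n \<mu>" and a: "a \<le> n"
    and eqJ: "\<And>i. 1 \<le> i \<Longrightarrow> i \<le> a \<Longrightarrow> Poly_Mapping.lookup \<mu> i = J"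
    and leJ: "\<And>i. Poly_Mapping.lookup \<mu> i \<le> J"
  shows "column_factor n (n - a) * Poly_Mapping.single \<mu> 1 \<in> demazure_cone n a (Suc J) (total_degree \<mu> + a)"
proof -
  define \<omega> :: "nat \<Rightarrow>\<^sub>0 nat" where "\<omega> = (\<Sum>i\<in>{1..a}. Poly_Mapping.single i 1)"
  have look: "Poly_Mapping.lookup \<omega> i = (if i \<in> {1..a} then 1 else 0)" for i
    by (simp add: \<omega>_def lookup_sum lookup_single when_def)
  have X\<omega>: "(\<Prod>i=1..a. X i) = (Poly_Mapping.single \<omega> 1 :: int mpoly)"
    using prod_X_power[of "{1..a}" "\<lambda>_. 1"] by (simp add: \<omega>_def)
  have deg: "total_degree \<omega> = a"
    by (subst total_degree_superset[of "{1..a}"]) (auto simp: look in_keys_iff split: if_splits)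
  have "Poly_Mapping.single (\<mu> + \<omega>) 1 * (\<Prod>k=a + 1..n. 1 - X k) \<in> demazure_cone n a (Suc J) (total_degree (\<mu> + \<omega>))"
  proof (rule monomial_times_tail)
    show "dominant n (\<mu> + \<omega>)"
      using dom a by (auto simp: dominant_def compositions_iff look lookup_add)
    show "Poly_Mapping.lookup (\<mu> + \<omega>) k < Poly_Mapping.lookup (\<mu> + \<omega>) i"
      if "1 \<le> i" "i \<le> a" "a < k" "k \<le> n" for i k
      using dominant_antimono[OF dom, of i k] that by (simp add: look lookup_add)
  qed (use a eqJ leJ in \<open>auto simp: look lookup_add le_SucI less_Suc_eq_le\<close>)
  moreover have "column_factor n (n - a) * Poly_Mapping.single \<mu> 1 =
      Poly_Mapping.single (\<mu> + \<omega>) 1 * (\<Prod>k=a + 1..n. 1 - X k)"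
  proof -
    have "Poly_Mapping.single (\<mu> + \<omega>) (1::int) = Poly_Mapping.single \<mu> 1 * Poly_Mapping.single \<omega> 1"
      by (simp add: mult_single)
    moreover have "n - (n - a) = a" using a by simp
    ultimately show ?thesis by (simp only: column_factor_def X\<omega> mult_ac)
  qed
  ultimately show ?thesis by (simp add: total_degree_add deg)
qed

lemma demazure_cone_column_factor:
  assumes "f \<in> demazure_cone n a J d" and a: "a \<le> n"
  shows "column_factor n (n - a) * f \<in> demazure_cone n a (Suc J) (d + a)"
  using assms(1)
proof induction
  case (add g \<mu> us)
  let ?c = "column_factor n (n - a)" and ?m = "Poly_Mapping.single \<mu> 1 :: int mpoly"
  have "swap_vars k ?c = ?c" if "k \<in> set us" for k
    by (rule swap_vars_column_factor) (use that add.hyps a in auto)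
  then have "?c * foldr pi_bar us ?m = foldr pi_bar us (?c * ?m)"
    by (simp add: foldr_pi_bar_symmetric_mult)
  also have "\<dots> \<in> demazure_cone n a (Suc J) (total_degree \<mu> + a)"
    using column_factor_times_monomial[OF add.hyps(2) a add.hyps(3,4)] add.hyps(5)
    by (intro demazure_cone_word)
  finally have "(-1) ^ (total_degree \<mu> + d) * (?c * foldr pi_bar us ?m) \<in> demazure_cone n a (Suc J) (d + a)"
    by (rule demazure_cone_sign) auto
  from demazure_cone_add[OF add.IH this] show ?case
    by (simp only: distrib_left mult.left_commute)
qed (simp add: demazure_cone.zero)

text \<open>
  The factor with the largest \<open>c x\<close> is multiplied last, so that \<open>n - c x\<close> is at most the length of the constant
  initial segment obtained from the other factors.
\<close>

lemma prod_column_factor_cone: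
  assumes "finite S" "\<And>j. j \<in> S \<Longrightarrow> c j \<le> n" "\<And>j. j \<in> S \<Longrightarrow> a \<le> n - c j"
  shows "(\<Prod>j\<in>S. column_factor n (c j)) \<in> demazure_cone n a (card S) (\<Sum>j\<in>S. n - c j)"
  using assms
proof (induction S arbitrary: a rule: finite_ranking_induct[where f = c])
  case empty
  have "dominant n 0" by (simp add: dominant_def compositions_iff)
  from demazure_cone_monomial[OF this, of a 0] show ?case by (simp add: total_degree_def)
next
  case (insert x S)
  show ?case
  proof (cases "x \<in> S")
    case True
    then show ?thesis using insert by (simp add: insert_absorb)
  next
    case False
    have cx: "c x \<le> n" "a \<le> n - c x" using insert.prems by auto
    have "(\<Prod>j\<in>S. column_factor n (c j)) \<in> demazure_cone n (n - c x) (card S) (\<Sum>j\<in>S. n - c j)"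
      using insert by (intro insert.IH) (auto simp: diff_le_mono2)
    from demazure_cone_column_factor[OF this]
    have "column_factor n (c x) * (\<Prod>j\<in>S. column_factor n (c j))
        \<in> demazure_cone n (n - c x) (Suc (card S)) ((\<Sum>j\<in>S. n - c j) + (n - c x))"
      using cx by simp
    from demazure_cone_mono[OF this cx(2)] show ?thesis
      using insert.hyps False by (simp add: add.commute)
  qed
qed

lemma demazure_cone_lascoux:
  assumes "f \<in> demazure_cone n 0 J d"
  shows "\<exists>A c. finite A \<and> A \<subseteq> compositions n \<and> (\<forall>\<alpha>. (0::int) \<le> c \<alpha>) \<and> (\<forall>\<alpha>. \<alpha> \<notin> A \<longrightarrow> c \<alpha> = 0) \<and>
      f = (\<Sum>\<alpha>\<in>A. (-1) ^ (total_degree \<alpha> + d) * of_int (c \<alpha>) * lascoux n \<alpha>)"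
  using assms
proof induction
  case zero
  show ?case by (rule exI[of _ "{}"], rule exI[of _ "\<lambda>_. 0"]) simp
next
  case (add g \<mu> us)
  let ?s = "\<lambda>\<alpha>. (-1) ^ (total_degree \<alpha> + d) :: int mpoly"
  obtain A c where A: "finite A" "A \<subseteq> compositions n" "\<And>\<alpha>. (0::int) \<le> c \<alpha>" "\<And>\<alpha>. \<alpha> \<notin> A \<Longrightarrow> c \<alpha> = 0"
    and g: "g = (\<Sum>\<alpha>\<in>A. ?s \<alpha> * of_int (c \<alpha>) * lascoux n \<alpha>)"
    using add.IH by blast
  have "set us \<subseteq> {1..<n}" using add.hyps(5) by auto
  then obtain \<beta> where \<beta>: "\<beta> \<in> compositions n" "total_degree \<beta> = total_degree \<mu>"
    "foldr pi_bar us (Poly_Mapping.single \<mu> 1) = lascoux n \<beta>"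
    using pi_bar_word_dominant[OF add.hyps(2)] by metis
  let ?A = "insert \<beta> A" and ?c = "\<lambda>\<alpha>. c \<alpha> + (if \<alpha> = \<beta> then 1 else 0)"
  have "g = (\<Sum>\<alpha>\<in>?A. ?s \<alpha> * of_int (c \<alpha>) * lascoux n \<alpha>)"
    unfolding g by (rule sum.mono_neutral_left) (use A in auto)
  moreover have "(\<Sum>\<alpha>\<in>?A. ?s \<alpha> * of_int (if \<alpha> = \<beta> then 1 else 0) * lascoux n \<alpha>) = ?s \<beta> * lascoux n \<beta>"
    using A(1) by (simp add: if_distrib if_distribR sum.delta cong: if_cong)
  ultimately have "g + ?s \<mu> * foldr pi_bar us (Poly_Mapping.single \<mu> 1)
      = (\<Sum>\<alpha>\<in>?A. ?s \<alpha> * of_int (?c \<alpha>) * lascoux n \<alpha>)"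
    using \<beta> by (simp only: of_int_add distrib_left distrib_right sum.distrib)
  then show ?case
    using A \<beta>(1) by (intro exI[of _ ?A] exI[of _ ?c]) auto
qed

section \<open>The lowest degree and the conclusion\<close>

lemma order_ge_pi_bar:
  assumes "order_ge d f"
  shows "order_ge d (pi_bar i f)"
proof -
  have "order_ge (1 + 0 + d) (X i * (1 - X (Suc i)) * f)"
    by (intro order_ge_mult order_ge_X assms order_ge_0)
  then show ?thesis unfolding pi_bar_alt by (intro order_ge_div_diff) simp
qed

lemma order_ge_column_factor: "order_ge (n - a) (column_factor n a)"
proof -
  have "order_ge (\<Sum>k=1..n - a. 1) (\<Prod>k=1..n - a. X k :: int mpoly)"
    by (rule order_ge_prod) (rule finite_atLeastAtMost, rule order_ge_X)
  then have "order_ge ((n - a) + 0) (column_factor n a)"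
    unfolding column_factor_def by (intro order_ge_mult) auto
  then show ?thesis by simp
qed

lemma increasing_perm_id:
  assumes w: "w permutes {1..n}" and inc: "\<And>i. 1 \<le> i \<Longrightarrow> i < n \<Longrightarrow> w i < w (Suc i)"
  shows "w = id"
proof -
  have *: "w i + (j - i) \<le> w j" if "1 \<le> i" "i \<le> j" "j \<le> n" for i j
    using that(2,3)
  proof (induction j rule: dec_induct)
    case (step j)
    then show ?case using inc[of j] that(1) by simp
  qed simp
  have "w i = i" for i
  proof (cases "i \<in> {1..n}")
    case True
    then have "w 1 \<in> {1..n}" "w n \<in> {1..n}" using permutes_in_image[OF w] by auto
    then show ?thesis using *[of 1 i] *[of i n] True by auto
  qed (use w in \<open>simp add: permutes_not_in\<close>)
  then show ?thesis by auto
qed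

text \<open>
  Each descent of \<open>w\<close> can be undone by one \<open>co_diff\<close>, which raises the order by at least one; sorting \<open>w\<close> takes
  \<open>inversions n w\<close> steps.
\<close>

lemma order_ge_co_schubert_id:
  assumes "w permutes {1..n}" "order_ge d (co_schubert n w)"
  shows "order_ge (d + inversions n w) (co_schubert n id)"
  using assms
proof (induction "inversions n w" arbitrary: w d rule: less_induct)
  case less
  note w = less.prems(1)
  show ?case
  proof (cases "\<exists>i. 1 \<le> i \<and> i < n \<and> w (Suc i) < w i")
    case True
    then obtain i where i: "1 \<le> i" "i < n" "w (Suc i) < w i" by blast
    let ?v = "swap_at w i"
    have asc: "ascent n ?v i" using i by (simp add: ascent_def)
    have v: "?v permutes {1..n}" "swap_at ?v i = w" using swap_at_permutes[OF w i(1,2)] by (auto simp: comp_assoc)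
    have inv: "inversions n w = Suc (inversions n ?v)" using inversions_swap_ascent[OF asc] v(2) by simp
    have "order_ge (Suc d) (co_schubert n ?v)"
      unfolding co_schubert_ascent[OF v(1) asc] v(2) by (rule order_ge_co_diff[OF less.prems(2)])
    from less.hyps[OF _ v(1) this] show ?thesis using inv by simp
  next
    case False
    have "w i < w (Suc i)" if "1 \<le> i" "i < n" for i
      using False that injD[OF permutes_inj[OF w], of i "Suc i"] by (meson n_not_Suc_n nat_neq_iff)
    then have "w = id" using increasing_perm_id[OF w] by blast
    moreover have "inversion_pairs n id = {}" by (auto simp: inversion_pairs_def)
    then have "inversions n id = 0" by (simp add: inversions_eq_card)
    ultimately show ?thesis using less.prems by simp
  qed
qed

text \<open>
  The identity is vexillary and its diagram is empty, so the word formula applies; every operator fixes a symmetric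
  polynomial.
\<close>

lemma co_schubert_id: "co_schubert n id = (\<Prod>k=1..n. X k ^ n)"
proof -
  have "vexillary n id" by (auto simp: vexillary_def)
  then obtain us where us: "set us \<subseteq> {1..<n}"
    and "co_schubert n id = foldr pi_bar us (\<Prod>j=1..n. factor_of n id j)"
    using co_schubert_vexillary[OF permutes_id] by blast
  moreover have "column n id j = {}" for j by (auto simp: column_def)
  moreover define p where "p = (\<Prod>k=1..n. X k ^ n :: int mpoly)"
  have "(\<Prod>j=1..n. column_factor n 0) = p"
    by (simp add: column_factor_def p_def prod_power_distrib)
  moreover have "foldr pi_bar us (p * 1) = p * foldr pi_bar us 1"
  proof (rule foldr_pi_bar_symmetric_mult)
    fix k assume "k \<in> set us"
    then have "swap_vars k (\<Prod>k=1..n. X k :: int mpoly) = (\<Prod>k=1..n. X k)"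
      using us by (intro swap_vars_prod_X) auto
    then show "swap_vars k p = p"
      by (simp add: p_def prod_power_distrib[symmetric] ring_hom_power[OF ring_hom_swap_vars])
  qed
  moreover have "foldr pi_bar us (1 :: int mpoly) = 1" by (induction us) (auto simp: pi_bar_1)
  ultimately show ?thesis by (simp add: p_def)
qed

lemma not_order_ge_co_schubert_id: "\<not> order_ge (Suc (n * n)) (co_schubert n id)"
proof -
  define m where "m = (\<Sum>k=1..n. Poly_Mapping.single k n)"
  have look: "Poly_Mapping.lookup m i = (if i \<in> {1..n} then n else 0)" for i
    by (simp add: m_def lookup_sum lookup_single when_def)
  have "total_degree m = n * n"
    using total_degree_compositions[of m n] by (simp add: compositions_iff look)
  moreover have "co_schubert n id = Poly_Mapping.single m 1"
    unfolding co_schubert_id m_def by (rule prod_X_power) simp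
  ultimately show ?thesis by (simp add: order_ge_def)
qed

lemma lowest_degreeI:
  assumes "order_ge d f" "\<not> order_ge (Suc d) f"
  shows "lowest_degree f = d"
proof -
  obtain m where m: "m \<in> Poly_Mapping.keys f" "total_degree m = d"
    using assms by (auto simp: order_ge_def not_le less_Suc_eq_le intro: le_antisym)
  show ?thesis unfolding lowest_degree_def
    by (rule Min_eqI) (use assms(1) m in \<open>auto simp: order_ge_def\<close>)
qed

theorem corollary1p3:
  fixes n :: nat and w :: "nat \<Rightarrow> nat"
  assumes "w permutes {1..n}" and "vexillary n w"
  shows "\<exists>f :: int mpoly.
    to_fract f = (\<Prod>i=1..n. to_fract (X i) ^ n) *
      eval_double (\<lambda>i. inverse (to_fract (X (n + 1 - i)))) (\<lambda>j. 1) (double_schubert n w) \<and>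
    graded_nonneg_lascoux n f"
proof -
  let ?f = "co_schubert n w" and ?c = "\<lambda>j. card (column n w j)"
  define d where "d = (\<Sum>j=1..n. n - ?c j)"
  obtain us where us: "set us \<subseteq> {1..<n}" "?f = foldr pi_bar us (\<Prod>j=1..n. column_factor n (?c j))"
    using co_schubert_vexillary[OF assms] by blast
  have "?f \<in> demazure_cone n 0 n d"
    unfolding us(2) d_def
    using prod_column_factor_cone[of "{1..n}" ?c n 0] us(1) card_column_le
    by (intro demazure_cone_word) auto
  from demazure_cone_lascoux[OF this] obtain A c where A: "finite A" "A \<subseteq> compositions n"
    "\<forall>\<alpha>. (0::int) \<le> c \<alpha>" "\<forall>\<alpha>. \<alpha> \<notin> A \<longrightarrow> c \<alpha> = 0"
    "?f = (\<Sum>\<alpha>\<in>A. (-1) ^ (total_degree \<alpha> + d) * of_int (c \<alpha>) * lascoux n \<alpha>)"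
    by (elim exE conjE) (rule that)
  have "order_ge d (\<Prod>j=1..n. column_factor n (?c j))"
    unfolding d_def by (rule order_ge_prod) (auto intro: order_ge_column_factor)
  then have ge: "order_ge d ?f"
    unfolding us(2) by (induction us) (auto intro: order_ge_pi_bar)
  have "d + inversions n w = (\<Sum>j=1..n. (n - ?c j) + ?c j)"
    unfolding d_def sum_card_column[OF assms(1), symmetric] by (rule sum.distrib[symmetric])
  also have "\<dots> = n * n" using card_column_le by simp
  finally have sum: "d + inversions n w = n * n" .
  \<comment> \<open>Otherwise the polynomial of the identity would have order larger than \<open>n * n\<close>.\<close>
  have "\<not> order_ge (Suc d) ?f"
  proof
    assume "order_ge (Suc d) ?f"
    from order_ge_co_schubert_id[OF assms(1) this] show False
      using not_order_ge_co_schubert_id[of n] sum by simp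
  qed
  then have "lowest_degree ?f = d" "?f \<noteq> 0" using ge lowest_degreeI by auto
  then have "graded_nonneg_lascoux n ?f"
    unfolding graded_nonneg_lascoux_def using A(1-3)
    by (intro conjI exI[of _ A] exI[of _ c]) (simp_all only: A(5)[symmetric], simp_all)
  then show ?thesis
    using reflects_to_fract[OF reflects_co_schubert[OF assms(1)]] by blast
qed

end
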